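(* Let $p\in[0,1]$ and let $W:[0,1]^2\to[0,1]$ be the graphon which is $0$ on $[0,1/2)^2\cup[1/2,1]^2$ and $p$ everywhere else. Then $W$ is forced by $X_5$ alone; that is, every graphon $U$ such that $X_5(U)$ and $X_5(W)$ have the same distribution is weakly isomorphic to $W$.
   Context: A graphon is a measurable symmetric function $W:[0,1]^2\to[0,1]$ (Lebesgue measure on $[0,1]$). For an integer $k\ge 1$, the $k$-sample $\mathbb G(k,W)$ is the random graph on $\{1,\dots,k\}$ obtained by sampling $x_1,\dots,x_k\in[0,1]$ uniformly at random and making each pair $\{i,j\}\subseteq\{1,\dots,k\}$ with $i\ne j$ an edge with probability $W(x_i,x_j)$, all these choices being mutually independent. $X_k(W)$ denotes the number of edges of $\mathbb G(k,W)$. Two graphons $U,W$ are weakly isomorphic if $\mathbb G(k,U)$ and $\mathbb G(k,W)$ have the same distribution for every $k\in\mathbb N$. *)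

theory Defs
  imports "HOL-Probability.Probability"
begin

text \<open>
  Graphons are Lebesgue (not merely Borel) measurable. They are total functions here, but only their
  values on the unit square matter.
\<close>

definition graphon :: "(real \<Rightarrow> real \<Rightarrow> real) \<Rightarrow> bool" where
  "graphon W \<longleftrightarrow>
     (\<lambda>(x, y). W x y) \<in> borel_measurable (lebesgue_on ({0..1} \<times> {0..1})) \<and>
     (\<forall>x\<in>{0..1}. \<forall>y\<in>{0..1}. W x y = W y x \<and> W x y \<in> {0..1})"

definition vertex_pairs :: "nat \<Rightarrow> nat set set" where
  "vertex_pairs k = {e. e \<subseteq> {1..k} \<and> card e = 2}"

text \<open>
  The completion makes \<open>x \<mapsto> W (x i) (x j)\<close> measurable also when \<open>W\<close> is only Lebesgue measurable.
\<close>

definition vertex_types :: "nat \<Rightarrow> (nat \<Rightarrow> real) measure" where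
  "vertex_types k = completion (\<Pi>\<^sub>M i\<in>{1..k}. restrict_space lborel {0..1})"

text \<open>
  A graph on \<open>{1..k}\<close> is given by its edge set. For \<open>i < j\<close> and \<open>e = {i, j}\<close>, the edge
  probability below is \<open>W (x i) (x j)\<close>; by symmetry of \<open>W\<close> the order is irrelevant.
\<close>

definition edges_given_types ::
  "nat \<Rightarrow> (real \<Rightarrow> real \<Rightarrow> real) \<Rightarrow> (nat \<Rightarrow> real) \<Rightarrow> nat set set pmf" where
  "edges_given_types k W x =
     map_pmf (\<lambda>b. {e \<in> vertex_pairs k. b e})
       (Pi_pmf (vertex_pairs k) False (\<lambda>e. bernoulli_pmf (W (x (Min e)) (x (Max e)))))"

definition graph_sample :: "nat \<Rightarrow> (real \<Rightarrow> real \<Rightarrow> real) \<Rightarrow> nat set set measure" where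
  "graph_sample k W = vertex_types k \<bind> (\<lambda>x. measure_pmf (edges_given_types k W x))"

definition edge_count_distr :: "nat \<Rightarrow> (real \<Rightarrow> real \<Rightarrow> real) \<Rightarrow> nat measure" where
  "edge_count_distr k W = distr (graph_sample k W) (count_space UNIV) card"

definition weakly_isomorphic ::
  "(real \<Rightarrow> real \<Rightarrow> real) \<Rightarrow> (real \<Rightarrow> real \<Rightarrow> real) \<Rightarrow> bool" where
  "weakly_isomorphic U W \<longleftrightarrow> (\<forall>k\<ge>1. graph_sample k U = graph_sample k W)"

definition bipartite_graphon :: "real \<Rightarrow> real \<Rightarrow> real \<Rightarrow> real" where
  "bipartite_graphon p x y =
     (if (x, y) \<in> {0..<1/2} \<times> {0..<1/2} \<union> {1/2..1} \<times> {1/2..1} then 0 else p)"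

lemma finite_vertex_pairs [simp]: "finite (vertex_pairs k)"
  by (rule finite_subset[of _ "Pow {1..k}"]) (auto simp: vertex_pairs_def)

lemma vertex_pairs_MinMax:
  assumes "e \<in> vertex_pairs k"
  shows "Min e \<in> {1..k}" "Max e \<in> {1..k}" "Min e < Max e" "e = {Min e, Max e}"
proof -
  from assms obtain i j where e: "e = {i, j}" "i \<noteq> j" and s: "e \<subseteq> {1..k}"
    by (auto simp: vertex_pairs_def card_2_iff)
  show "Min e \<in> {1..k}" "Max e \<in> {1..k}" "Min e < Max e" "e = {Min e, Max e}"
    using e s by (auto simp: min_def max_def)
qed

lemma graphon_bipartite_graphon:
  assumes "p \<in> {0..1}"
  shows "graphon (bipartite_graphon p)"
proof -
  have "(\<lambda>(x, y). bipartite_graphon p x y) \<in> borel_measurable (borel \<Otimes>\<^sub>M borel)"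
    unfolding bipartite_graphon_def by measurable
  then have "(\<lambda>(x, y). bipartite_graphon p x y) \<in> borel_measurable lebesgue"
    by (intro measurable_completion) (simp add: borel_prod)
  then have "(\<lambda>(x, y). bipartite_graphon p x y)
               \<in> borel_measurable (lebesgue_on ({0..1} \<times> {0..1}))"
    by (rule measurable_restrict_space1)
  with assms show ?thesis
    by (auto simp: graphon_def bipartite_graphon_def)
qed

lemma prob_space_unit_interval: "prob_space (restrict_space lborel {0..1::real})"
  by (rule prob_space_restrict_space) auto

lemma prob_space_vertex_types: "prob_space (vertex_types k)"
  unfolding vertex_types_def
  by (intro prob_space.prob_space_completion prob_space_PiM prob_space_unit_interval)

lemma distr_vertex_types_pair:
  assumes "i \<in> {1..k}" "j \<in> {1..k}" "i \<noteq> j"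
  shows "distr (\<Pi>\<^sub>M i\<in>{1..k}. restrict_space lborel {0..1}) (borel \<Otimes>\<^sub>M borel) (\<lambda>x. (x i, x j))
           = distr (restrict_space lborel {0..1::real} \<Otimes>\<^sub>M restrict_space lborel {0..1::real})
               (borel \<Otimes>\<^sub>M borel) (\<lambda>z. z)"
    (is "distr ?P _ _ = distr (?A \<Otimes>\<^sub>M ?A) _ _")
proof -
  have [measurable]: "(\<lambda>x. x l) \<in> ?P \<rightarrow>\<^sub>M ?A" if "l \<in> {1..k}" for l
    using that by (rule measurable_component_singleton)
  have id: "(\<lambda>x. x) \<in> ?A \<rightarrow>\<^sub>M borel"
    by (rule measurable_restrict_space1) simp
  have id2: "(\<lambda>z. z) \<in> ?A \<Otimes>\<^sub>M ?A \<rightarrow>\<^sub>M borel \<Otimes>\<^sub>M borel"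
  proof -
    have "(\<lambda>z. (fst z, snd z)) \<in> ?A \<Otimes>\<^sub>M ?A \<rightarrow>\<^sub>M borel \<Otimes>\<^sub>M borel"
      by (intro measurable_Pair measurable_compose[OF measurable_fst id]
            measurable_compose[OF measurable_snd id])
    then show ?thesis by simp
  qed
  have m: "(\<lambda>x. (x i, x j)) \<in> ?P \<rightarrow>\<^sub>M ?A \<Otimes>\<^sub>M ?A"
    using assms by measurable
  have "?A \<Otimes>\<^sub>M ?A = distr ?P (?A \<Otimes>\<^sub>M ?A) (\<lambda>x. (x i, x j))"
  proof (rule pair_measure_eqI)
    show "sigma_finite_measure ?A" "sigma_finite_measure ?A"
      using prob_space_unit_interval by (auto intro: prob_space_imp_sigma_finite)
    fix B C assume B: "B \<in> sets ?A" and C: "C \<in> sets ?A"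
    let ?X = "\<lambda>l. if l = i then B else C"
    have BC: "B \<subseteq> space ?A" "C \<subseteq> space ?A"
      by (rule sets.sets_into_space[OF B], rule sets.sets_into_space[OF C])
    have "emeasure (distr ?P (?A \<Otimes>\<^sub>M ?A) (\<lambda>x. (x i, x j))) (B \<times> C)
            = emeasure ?P ((\<lambda>x. (x i, x j)) -` (B \<times> C) \<inter> space ?P)"
      using m B C by (intro emeasure_distr) auto
    also have "(\<lambda>x. (x i, x j)) -` (B \<times> C) \<inter> space ?P
                 = prod_emb {1..k} (\<lambda>_. ?A) {i, j} (Pi\<^sub>E {i, j} ?X)"
      using assms BC by (auto simp: prod_emb_def space_PiM restrict_PiE_iff)
    also have "emeasure ?P \<dots> = (\<Prod>l\<in>{i, j}. emeasure ?A (?X l))"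
      using assms B C prob_space_unit_interval by (intro emeasure_PiM_emb) auto
    also have "\<dots> = emeasure ?A B * emeasure ?A C"
      using assms by simp
    finally show "emeasure ?A B * emeasure ?A C
                    = emeasure (distr ?P (?A \<Otimes>\<^sub>M ?A) (\<lambda>x. (x i, x j))) (B \<times> C)" ..
  qed simp
  then have "distr (?A \<Otimes>\<^sub>M ?A) (borel \<Otimes>\<^sub>M borel) (\<lambda>z. z)
      = distr (distr ?P (?A \<Otimes>\<^sub>M ?A) (\<lambda>x. (x i, x j))) (borel \<Otimes>\<^sub>M borel) (\<lambda>z. z)"
    by simp
  also have "\<dots> = distr ?P (borel \<Otimes>\<^sub>M borel) (\<lambda>x. (x i, x j))"
    by (subst distr_distr[OF id2 m]) (simp add: comp_def)
  finally show ?thesis ..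
qed

lemma null_sets_square:
  assumes "N \<in> null_sets (lborel :: (real \<times> real) measure)"
  shows "emeasure (distr (restrict_space lborel {0..1::real} \<Otimes>\<^sub>M restrict_space lborel {0..1::real})
               (borel \<Otimes>\<^sub>M borel) (\<lambda>z. z)) N = 0"
    (is "emeasure (distr (?A \<Otimes>\<^sub>M ?A) _ _) N = 0")
proof -
  interpret A: prob_space ?A by (rule prob_space_unit_interval)
  have N: "N \<in> sets (borel \<Otimes>\<^sub>M borel)" "emeasure (lborel \<Otimes>\<^sub>M lborel) N = 0"
    using assms unfolding borel_prod lborel_prod by (auto simp: null_sets_def)
  have id: "(\<lambda>x. x) \<in> ?A \<rightarrow>\<^sub>M borel"
    by (rule measurable_restrict_space1) simp
  have id2: "(\<lambda>z. z) \<in> ?A \<Otimes>\<^sub>M ?A \<rightarrow>\<^sub>M borel \<Otimes>\<^sub>M borel"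
  proof -
    have "(\<lambda>z. (fst z, snd z)) \<in> ?A \<Otimes>\<^sub>M ?A \<rightarrow>\<^sub>M borel \<Otimes>\<^sub>M borel"
      by (intro measurable_Pair measurable_compose[OF measurable_fst id]
            measurable_compose[OF measurable_snd id])
    then show ?thesis by simp
  qed
  let ?N = "N \<inter> space (?A \<Otimes>\<^sub>M ?A)"
  have N': "?N \<in> sets (?A \<Otimes>\<^sub>M ?A)"
    using measurable_sets[OF id2 N(1)] by simp
  have N'': "N \<in> sets (lborel \<Otimes>\<^sub>M lborel)"
    using N(1) by (simp add: lborel_prod borel_prod)
  have slice: "Pair x -` N \<in> sets lborel" for x
    using sets_Pair1[OF N''] .
  have "emeasure (distr (?A \<Otimes>\<^sub>M ?A) (borel \<Otimes>\<^sub>M borel) (\<lambda>z. z)) N = emeasure (?A \<Otimes>\<^sub>M ?A) ?N"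
    using emeasure_distr[OF id2 N(1)] by simp
  also have "\<dots> = (\<integral>\<^sup>+x. emeasure ?A (Pair x -` ?N) \<partial>?A)"
    by (rule A.emeasure_pair_measure_alt[OF N'])
  also have "\<dots> \<le> (\<integral>\<^sup>+x. emeasure lborel (Pair x -` N) \<partial>?A)"
  proof (rule nn_integral_mono)
    fix x assume x: "x \<in> space ?A"
    have "Pair x -` ?N \<subseteq> {0..1}"
      by (auto simp: space_pair_measure space_restrict_space)
    then have "emeasure ?A (Pair x -` ?N) = emeasure lborel (Pair x -` ?N)"
      by (intro emeasure_restrict_space) auto
    also have "\<dots> \<le> emeasure lborel (Pair x -` N)"
      using slice by (intro emeasure_mono) auto
    finally show "emeasure ?A (Pair x -` ?N) \<le> emeasure lborel (Pair x -` N)" .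
  qed
  also have "\<dots> = (\<integral>\<^sup>+x. emeasure lborel (Pair x -` N) * indicator {0..1} x \<partial>lborel)"
    by (rule nn_integral_restrict_space) auto
  also have "\<dots> \<le> (\<integral>\<^sup>+x. emeasure lborel (Pair x -` N) \<partial>lborel)"
    by (intro nn_integral_mono) (auto simp: indicator_def)
  also have "\<dots> = emeasure (lborel \<Otimes>\<^sub>M lborel) N"
    by (rule lborel.emeasure_pair_measure_alt[symmetric, OF N''])
  also have "\<dots> = 0" by (rule N(2))
  finally show ?thesis by simp
qed

lemma measurable_graphon_vertex_types:
  assumes W: "graphon W" and ij: "i \<in> {1..k}" "j \<in> {1..k}" "i \<noteq> j"
  shows "(\<lambda>x. W (x i) (x j)) \<in> borel_measurable (vertex_types k)"
proof -
  let ?A = "restrict_space lborel {0..1::real}"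
  let ?P = "\<Pi>\<^sub>M i\<in>{1..k}. ?A"
  let ?f = "\<lambda>x::nat \<Rightarrow> real. (x i, x j)"
  let ?g = "\<lambda>z. if z \<in> {0..1} \<times> {0..1} then (\<lambda>(x, y). W x y) z else 0"
  have id: "(\<lambda>x. x) \<in> ?A \<rightarrow>\<^sub>M borel"
    by (rule measurable_restrict_space1) simp
  have c: "(\<lambda>x. x l) \<in> ?P \<rightarrow>\<^sub>M borel" if "l \<in> {1..k}" for l
    by (rule measurable_compose[OF _ id, where f = "\<lambda>x. x l"])
      (rule measurable_component_singleton[OF that])
  have f: "?f \<in> ?P \<rightarrow>\<^sub>M borel \<Otimes>\<^sub>M borel"
    using ij by (intro measurable_Pair c)
  have f': "?f \<in> completion ?P \<rightarrow>\<^sub>M lborel"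
    using measurable_completion[OF f] by (simp add: borel_prod)
  have "null_sets lborel \<subseteq> null_sets (distr (completion ?P) lborel ?f)"
  proof
    fix N assume N: "N \<in> null_sets (lborel :: (real \<times> real) measure)"
    have N': "N \<in> sets (borel \<Otimes>\<^sub>M borel)" "N \<in> sets lborel"
      using N unfolding borel_prod by (auto simp: null_sets_def)
    have "emeasure (distr (completion ?P) lborel ?f) N = emeasure (completion ?P) (?f -` N \<inter> space ?P)"
      using emeasure_distr[OF f' N'(2)] by simp
    also have "\<dots> = emeasure ?P (?f -` N \<inter> space ?P)"
      using measurable_sets[OF f N'(1)] by (subst emeasure_completion) (auto simp del: One_nat_def)
    also have "\<dots> = emeasure (distr ?P (borel \<Otimes>\<^sub>M borel) ?f) N"
      by (rule emeasure_distr[symmetric, OF f N'(1)])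
    also have "\<dots> = 0"
      unfolding distr_vertex_types_pair[OF ij] by (rule null_sets_square[OF N])
    finally show "N \<in> null_sets (distr (completion ?P) lborel ?f)"
      using N by (auto simp: null_sets_def)
  qed
  then have "?f \<in> completion ?P \<rightarrow>\<^sub>M lebesgue"
    by (intro completion.measurable_completion2 f')
  moreover have "?g \<in> borel_measurable lebesgue"
  proof (rule borel_measurable_if_I)
    show "{0..1::real} \<times> {0..1::real} \<in> sets lebesgue"
      by (intro sets_completionI_sets) (simp add: borel_closed closed_Times)
  qed (use W in \<open>simp add: graphon_def\<close>)
  ultimately have "(\<lambda>x. ?g (?f x)) \<in> borel_measurable (completion ?P)"
    by (rule measurable_compose)
  moreover have "?g (?f x) = W (x i) (x j)" if "x \<in> space (completion ?P)" for x
  proof -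
    have "x i \<in> {0..1}" "x j \<in> {0..1}"
      using that ij by (auto simp: space_PiM space_restrict_space PiE_iff)
    then show ?thesis by simp
  qed
  ultimately show ?thesis
    unfolding vertex_types_def by (subst (asm) measurable_cong) auto
qed

lemma vertex_types_in_unit:
  assumes "x \<in> space (vertex_types k)" "i \<in> {1..k}"
  shows "x i \<in> {0..1}"
  using assms by (auto simp: vertex_types_def space_PiM space_restrict_space PiE_iff)

lemma pmf_edges_given_types:
  assumes W: "graphon W" and x: "x \<in> space (vertex_types k)" and G: "G \<subseteq> vertex_pairs k"
  shows "pmf (edges_given_types k W x) G =
           (\<Prod>e\<in>vertex_pairs k. if e \<in> G then W (x (Min e)) (x (Max e))
                                else 1 - W (x (Min e)) (x (Max e)))"
proof -
  let ?E = "vertex_pairs k"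
  let ?p = "Pi_pmf ?E False (\<lambda>e. bernoulli_pmf (W (x (Min e)) (x (Max e))))"
  let ?h = "\<lambda>b. {e \<in> ?E. b e}"
  have "pmf (edges_given_types k W x) G = measure (measure_pmf ?p) (?h -` {G})"
    by (simp add: edges_given_types_def pmf_map)
  also have "\<dots> = measure (measure_pmf ?p) {\<lambda>e. e \<in> G}"
  proof (rule measure_pmf.finite_measure_eq_AE)
    have "set_pmf ?p \<subseteq> {b. \<forall>e. e \<notin> ?E \<longrightarrow> b e = False}"
      using set_Pi_pmf_subset'[of ?E False] by (auto simp: PiE_dflt_def)
    then show "AE b in measure_pmf ?p. b \<in> ?h -` {G} \<longleftrightarrow> b \<in> {\<lambda>e. e \<in> G}"
      using G by (subst AE_measure_pmf_iff) (auto simp: fun_eq_iff)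
  qed auto
  also have "\<dots> = pmf ?p (\<lambda>e. e \<in> G)"
    by (simp add: pmf.rep_eq)
  also have "\<dots> = (\<Prod>e\<in>?E. pmf (bernoulli_pmf (W (x (Min e)) (x (Max e)))) (e \<in> G))"
    using G by (subst pmf_Pi) auto
  also have "\<dots> = (\<Prod>e\<in>?E. if e \<in> G then W (x (Min e)) (x (Max e))
                                else 1 - W (x (Min e)) (x (Max e)))"
  proof (rule prod.cong)
    fix e assume e: "e \<in> ?E"
    have "W (x (Min e)) (x (Max e)) \<in> {0..1}"
      using W vertex_types_in_unit[OF x] vertex_pairs_MinMax[OF e] by (simp add: graphon_def)
    then show "pmf (bernoulli_pmf (W (x (Min e)) (x (Max e)))) (e \<in> G) =
                 (if e \<in> G then W (x (Min e)) (x (Max e)) else 1 - W (x (Min e)) (x (Max e)))"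
      by auto
  qed simp
  finally show ?thesis .
qed

lemma set_pmf_edges_given_types: "set_pmf (edges_given_types k W x) \<subseteq> Pow (vertex_pairs k)"
  by (auto simp: edges_given_types_def)

lemma measurable_edges_given_types:
  assumes W: "graphon W"
  shows "(\<lambda>x. measure_pmf (edges_given_types k W x))
           \<in> vertex_types k \<rightarrow>\<^sub>M subprob_algebra (count_space UNIV)"
proof (rule measurable_subprob_algebra)
  fix A :: "nat set set set"
  let ?D = "\<lambda>G x. \<Prod>e\<in>vertex_pairs k. if e \<in> G then W (x (Min e)) (x (Max e))
                                else 1 - W (x (Min e)) (x (Max e))"
  have "?D G \<in> borel_measurable (vertex_types k)" for G
  proof (rule borel_measurable_prod)
    fix e assume e: "e \<in> vertex_pairs k"
    have "(\<lambda>x. W (x (Min e)) (x (Max e))) \<in> borel_measurable (vertex_types k)"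
      using vertex_pairs_MinMax[OF e] by (intro measurable_graphon_vertex_types[OF W]) auto
    then show "(\<lambda>x. if e \<in> G then W (x (Min e)) (x (Max e)) else 1 - W (x (Min e)) (x (Max e)))
                 \<in> borel_measurable (vertex_types k)"
      by (cases "e \<in> G") auto
  qed
  then have "(\<lambda>x. ennreal (\<Sum>G\<in>A \<inter> Pow (vertex_pairs k). ?D G x)) \<in> borel_measurable (vertex_types k)"
    by (intro measurable_compose[OF borel_measurable_sum measurable_ennreal])
  moreover have "emeasure (measure_pmf (edges_given_types k W x)) A
                   = ennreal (\<Sum>G\<in>A \<inter> Pow (vertex_pairs k). ?D G x)"
    if x: "x \<in> space (vertex_types k)" for x
  proof -
    let ?K = "edges_given_types k W x"
    have "emeasure (measure_pmf ?K) A = emeasure (measure_pmf ?K) (A \<inter> Pow (vertex_pairs k))"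
      using set_pmf_edges_given_types[of k W x]
      by (intro emeasure_eq_AE) (auto simp: AE_measure_pmf_iff)
    also have "\<dots> = ennreal (\<Sum>G\<in>A \<inter> Pow (vertex_pairs k). pmf ?K G)"
      by (subst emeasure_measure_pmf_finite) (auto simp: sum_ennreal)
    also have "(\<Sum>G\<in>A \<inter> Pow (vertex_pairs k). pmf ?K G)
                 = (\<Sum>G\<in>A \<inter> Pow (vertex_pairs k). ?D G x)"
      by (intro sum.cong refl pmf_edges_given_types[OF W x]) auto
    finally show ?thesis .
  qed
  ultimately show "(\<lambda>x. emeasure (measure_pmf (edges_given_types k W x)) A)
                     \<in> borel_measurable (vertex_types k)"
    by (subst measurable_cong) auto
qed (auto intro: prob_space_imp_subprob_space measure_pmf.prob_space_axioms)

lemma prob_space_graph_sample: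
  assumes "graphon W"
  shows "prob_space (graph_sample k W)"
proof -
  interpret prob_space "vertex_types k" by (rule prob_space_vertex_types)
  show ?thesis
    unfolding graph_sample_def
    by (rule prob_space_bind[OF _ measurable_edges_given_types[OF assms]])
       (auto intro: measure_pmf.prob_space_axioms)
qed

lemma emeasure_graph_sample:
  assumes "graphon W"
  shows "emeasure (graph_sample k W) A
           = (\<integral>\<^sup>+x. emeasure (measure_pmf (edges_given_types k W x)) A \<partial>vertex_types k)"
proof -
  interpret prob_space "vertex_types k" by (rule prob_space_vertex_types)
  show ?thesis
    unfolding graph_sample_def
    by (rule emeasure_bind[OF not_empty measurable_edges_given_types[OF assms]]) simp
qed

end

theory Submission
  imports Defs
begin

text \<open>
  The \<open>m\<close>-th factorial moment of \<open>X\<^sub>5(U)\<close> is, up to the factor \<open>m!\<close>, the sum of the homomorphism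
  densities in \<open>U\<close> of all graphs with \<open>m\<close> edges on \<open>{1..5}\<close>. Put \<open>d = p / 2\<close>. For \<open>m = 1, 2\<close> this determines the
  first two moments of the degree function, so almost all degrees are \<open>d\<close>. In a regular graphon a leaf
  contributes the factor \<open>d\<close>, and a graph on five vertices without leaves contains a
  triangle, a 4-cycle or a 5-cycle; hence \<open>m = 3, 4, 5\<close> yield in turn \<open>t(C\<^sub>3) = 0\<close>, \<open>t(C\<^sub>4) = 2 d^4\<close>
  and \<open>t(C\<^sub>5) = 0\<close>.

  Let \<open>c(x, y) = \<integral> U(x, z) U(y, z) dz\<close>. These values make the nonnegative integral
  \<open>\<integral> U(x, y) (c(x, z) + c(y, z) - 2 d\<^sup>2)\<^sup>2\<close> equal to \<open>2 d t(C\<^sub>4) + 2 t(C\<^sub>5) - 4 d^5 = 0\<close>. In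
  spectral terms, all eigenvalues of \<open>U\<close> other than the leading \<open>d\<close> are \<open>0\<close> or \<open>-d\<close>, and this gives
  \<open>c = 2 d\<^sup>2 - d U\<close>. As \<open>U c = 0\<close> by triangle-freeness, \<open>U\<close> takes the values \<open>0\<close> and
  \<open>2 d = p\<close> only, and the neighbourhood of a typical \<open>z\<close> is one side of a balanced bipartition between
  whose sides \<open>U = p\<close>.
\<close>

section \<open>Integrals of bounded functions of two variables\<close>

lemma (in prob_space) AE_imp_ex: "AE x in M. P x \<Longrightarrow> \<exists>x. P x"
  by (rule ccontr) auto

lemma (in prob_space) integrable_bounded:
  fixes f :: "'a \<Rightarrow> real"
  assumes "f \<in> borel_measurable M" "\<And>x. \<bar>f x\<bar> \<le> B"
  shows "integrable M f"
  using assms by (intro integrable_const_bound[where B = B]) auto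

text \<open>No integrability is assumed: the integral of a non-integrable function is 0 by
  convention, and \<open>B\<close> is nonnegative because it bounds an absolute value.\<close>

lemma (in prob_space) abs_integral_le:
  fixes f :: "'a \<Rightarrow> real"
  assumes "\<And>x. \<bar>f x\<bar> \<le> B"
  shows "\<bar>\<integral>x. f x \<partial>M\<bar> \<le> B"
proof (cases "integrable M f")
  case True
  have "\<bar>\<integral>x. f x \<partial>M\<bar> \<le> (\<integral>x. \<bar>f x\<bar> \<partial>M)"
    by (rule integral_abs_bound)
  also have "\<dots> \<le> B"
    using assms True by (intro integral_le_const) auto
  finally show ?thesis .
next
  case False
  then show ?thesis
    using order_trans[OF abs_ge_zero assms] by (simp add: not_integrable_integral_eq)
qed

lemma (in prob_space) Fubini_bounded:
  fixes f :: "'a \<Rightarrow> 'a \<Rightarrow> real"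
  assumes "(\<lambda>(x, y). f x y) \<in> borel_measurable (M \<Otimes>\<^sub>M M)" "\<And>x y. \<bar>f x y\<bar> \<le> B"
  shows "(\<integral>x. \<integral>y. f x y \<partial>M \<partial>M) = (\<integral>y. \<integral>x. f x y \<partial>M \<partial>M)"
proof -
  interpret P: pair_prob_space M M ..
  have "integrable (M \<Otimes>\<^sub>M M) (case_prod f)"
    using assms by (intro P.integrable_bounded[where B = B]) auto
  then show ?thesis
    by (rule P.Fubini_integral[symmetric])
qed

lemma (in prob_space) AE_eq_0_of_double_integral:
  fixes f :: "'a \<Rightarrow> 'a \<Rightarrow> real"
  assumes [measurable]: "(\<lambda>(x, y). f x y) \<in> borel_measurable (M \<Otimes>\<^sub>M M)"
    and B: "\<And>x y. \<bar>f x y\<bar> \<le> B" and pos: "\<And>x y. 0 \<le> f x y"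
    and 0: "(\<integral>x. \<integral>y. f x y \<partial>M \<partial>M) = 0"
  shows "AE x in M. AE y in M. f x y = 0"
proof -
  have m: "f x \<in> borel_measurable M" if "x \<in> space M" for x
    using that by measurable
  have "AE x in M. (\<integral>y. f x y \<partial>M) = 0"
  proof (subst integral_nonneg_eq_0_iff_AE[symmetric])
    have "AE x in M. norm (\<integral>y. f x y \<partial>M) \<le> B"
      using abs_integral_le[OF B] by (intro AE_I2) simp
    then show "integrable M (\<lambda>x. \<integral>y. f x y \<partial>M)"
      by (intro integrable_const_bound[where B = B]) auto
  qed (use pos 0 in auto)
  then show ?thesis
    using AE_space
  proof eventually_elim
    case (elim x)
    then show ?case
      using integral_nonneg_eq_0_iff_AE[OF integrable_bounded[OF m B], of x] pos by simp
  qed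
qed

text \<open>With respect to the product measure, \<open>h / C\<close> is the density of a measure
  that agrees with the product measure on all rectangles, hence everywhere; uniqueness of densities
  then gives \<open>h = C\<close> almost everywhere. Nonnegativity of \<open>h\<close> is what makes
  \<open>h / C\<close> a density.\<close>

lemma (in prob_space) AE_const_of_rectangle_integrals:
  fixes h :: "'a \<Rightarrow> 'a \<Rightarrow> real"
  assumes [measurable]: "(\<lambda>(x, y). h x y) \<in> borel_measurable (M \<Otimes>\<^sub>M M)"
    and B: "\<And>x y. \<bar>h x y\<bar> \<le> B" and pos: "\<And>x y. 0 \<le> h x y" and C: "0 < C"
    and rect: "\<And>S T. S \<in> sets M \<Longrightarrow> T \<in> sets M \<Longrightarrow>
      (\<integral>x. \<integral>y. indicator S x * indicator T y * h x y \<partial>M \<partial>M) = C * prob S * prob T"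
  shows "AE x in M. AE y in M. h x y = C"
proof -
  interpret P: pair_prob_space M M ..
  let ?D = "density (M \<Otimes>\<^sub>M M) (\<lambda>(x, y). ennreal (h x y / C))"
  have "M \<Otimes>\<^sub>M M = ?D"
  proof (rule pair_measure_eqI)
    show "sigma_finite_measure M" "sigma_finite_measure M" by unfold_locales
    show "sets (M \<Otimes>\<^sub>M M) = sets ?D" by simp
    fix S T assume [measurable]: "S \<in> sets M" "T \<in> sets M"
    let ?f = "\<lambda>x y. indicator S x * indicator T y * h x y / C"
    have i: "integrable (M \<Otimes>\<^sub>M M) (case_prod ?f)"
      using B pos C by (intro P.integrable_bounded[where B = "B / C"])
        (auto simp: abs_mult indicator_def divide_simps intro: order_trans[OF abs_ge_zero B])
    have "emeasure ?D (S \<times> T) = (\<integral>\<^sup>+z. (case z of (x, y) \<Rightarrow> ennreal (h x y / C)) * indicator (S \<times> T) z \<partial>(M \<Otimes>\<^sub>M M))"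
      by (rule emeasure_density) auto
    also have "\<dots> = (\<integral>\<^sup>+z. ennreal (case_prod ?f z) \<partial>(M \<Otimes>\<^sub>M M))"
    proof (rule nn_integral_cong)
      fix z
      show "(case z of (x, y) \<Rightarrow> ennreal (h x y / C)) * indicator (S \<times> T) z = ennreal (case_prod ?f z)"
        by (cases "fst z \<in> S"; cases "snd z \<in> T") (auto simp: split_beta indicator_times)
    qed
    also have "\<dots> = ennreal (\<integral>z. case_prod ?f z \<partial>(M \<Otimes>\<^sub>M M))"
      using pos C i by (intro nn_integral_eq_integral) auto
    also have "(\<integral>z. case_prod ?f z \<partial>(M \<Otimes>\<^sub>M M)) = (\<integral>x. \<integral>y. ?f x y \<partial>M \<partial>M)"
      by (rule P.integral_fst[OF i, symmetric])
    also have "\<dots> = prob S * prob T"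
      using rect[of S T] C by simp
    finally show "emeasure M S * emeasure M T = emeasure ?D (S \<times> T)"
      by (simp add: emeasure_eq_measure ennreal_mult)
  qed
  then have "density (M \<Otimes>\<^sub>M M) (\<lambda>_. 1) = ?D"
    by (simp add: density_1)
  then have "AE z in M \<Otimes>\<^sub>M M. 1 = (case z of (x, y) \<Rightarrow> ennreal (h x y / C))"
    by (intro P.density_unique) auto
  then have "AE z in M \<Otimes>\<^sub>M M. h (fst z) (snd z) = C"
    by eventually_elim (use pos C in \<open>auto simp: split_beta\<close>)
  then show ?thesis
    using P.AE_pair by fastforce
qed

section \<open>Degrees and codegrees\<close>

text \<open>A normal form for graphons: measurability refers to the product sigma-algebra without
  completion, while symmetry and bounds hold at all points. Iterated integrals are then measurable,
  and integrands can be bounded without almost-everywhere side conditions.\<close>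

locale edge_kernel = prob_space M for M :: "'a measure" +
  fixes U :: "'a \<Rightarrow> 'a \<Rightarrow> real"
  assumes kernel_measurable: "(\<lambda>(x, y). U x y) \<in> borel_measurable (M \<Otimes>\<^sub>M M)"
    and kernel_sym: "U x y = U y x"
    and kernel_nonneg: "0 \<le> U x y"
    and kernel_le_1: "U x y \<le> 1"
begin

sublocale P: pair_prob_space M M ..

lemma measurable_kernel [measurable (raw)]:
  assumes "f \<in> N \<rightarrow>\<^sub>M M" "g \<in> N \<rightarrow>\<^sub>M M"
  shows "(\<lambda>w. U (f w) (g w)) \<in> borel_measurable N"
  using measurable_compose[OF measurable_Pair[OF assms] kernel_measurable] by simp

lemma abs_kernel: "\<bar>U x y\<bar> \<le> 1"
  using kernel_nonneg[of x y] kernel_le_1[of x y] by simp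

lemma integrable_kernel [simp]: "x \<in> space M \<Longrightarrow> integrable M (U x)"
  using abs_kernel by (intro integrable_bounded[where B = 1]) auto

definition deg :: "'a \<Rightarrow> real" where
  "deg x = (\<integral>y. U x y \<partial>M)"

text \<open>By symmetry of \<open>U\<close>, this is the kernel of the square of the integral
  operator of \<open>U\<close>.\<close>

definition codeg :: "'a \<Rightarrow> 'a \<Rightarrow> real" where
  "codeg x y = (\<integral>z. U x z * U y z \<partial>M)"

lemma measurable_deg [measurable]: "deg \<in> borel_measurable M"
  unfolding deg_def by measurable

lemma measurable_codeg [measurable (raw)]:
  assumes "f \<in> N \<rightarrow>\<^sub>M M" "g \<in> N \<rightarrow>\<^sub>M M"
  shows "(\<lambda>w. codeg (f w) (g w)) \<in> borel_measurable N"
  using assms unfolding codeg_def by measurable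

lemma codeg_sym: "codeg x y = codeg y x"
  by (simp add: codeg_def mult.commute)

lemma deg_nonneg: "0 \<le> deg x"
  by (simp add: deg_def kernel_nonneg)

lemma codeg_nonneg: "0 \<le> codeg x y"
  by (simp add: codeg_def kernel_nonneg)

lemma integral_le_1:
  assumes "\<And>x. 0 \<le> f x" "\<And>x. f x \<le> 1"
  shows "(\<integral>x. f x \<partial>M) \<le> (1::real)"
proof (cases "integrable M f")
  case True
  then show ?thesis using assms by (intro integral_le_const) auto
qed (simp add: not_integrable_integral_eq)

lemma deg_le_1: "deg x \<le> 1"
  unfolding deg_def by (intro integral_le_1 kernel_nonneg kernel_le_1)

lemma codeg_le_1: "codeg x y \<le> 1"
  unfolding codeg_def by (intro integral_le_1 mult_nonneg_nonneg mult_le_one kernel_nonneg kernel_le_1)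

lemma abs_deg: "\<bar>deg x\<bar> \<le> 1"
  using deg_nonneg[of x] deg_le_1[of x] by simp

lemma abs_codeg: "\<bar>codeg x y\<bar> \<le> 1"
  using codeg_nonneg[of x y] codeg_le_1[of x y] by simp

text \<open>Homomorphism densities of the edge, the two-edge path and the cycles of length 3, 4 and
  5, as iterated integrals. In the 4-cycle, \<open>x\<close> and \<open>y\<close> are opposite
  vertices with two independent common neighbours; in the 5-cycle, \<open>x\<close> and
  \<open>y\<close> are adjacent and \<open>z\<close> is the vertex opposite to this edge.\<close>

definition t_edge :: real where "t_edge = (\<integral>x. deg x \<partial>M)"
definition t_path :: real where "t_path = (\<integral>x. (deg x)\<^sup>2 \<partial>M)"
definition t_C3 :: real where "t_C3 = (\<integral>x. \<integral>y. U x y * codeg x y \<partial>M \<partial>M)"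
definition t_C4 :: real where "t_C4 = (\<integral>x. \<integral>y. (codeg x y)\<^sup>2 \<partial>M \<partial>M)"
definition t_C5 :: real where
  "t_C5 = (\<integral>x. \<integral>y. U x y * (\<integral>z. codeg x z * codeg y z \<partial>M) \<partial>M \<partial>M)"

text \<open>The difference \<open>t_path - t_edge^2\<close> is the variance of the degree of a
  random point.\<close>

lemma AE_deg_const:
  assumes "t_path = t_edge\<^sup>2"
  shows "AE x in M. deg x = t_edge"
proof -
  have i: "integrable M deg" "integrable M (\<lambda>x. (deg x)\<^sup>2)"
    using abs_deg by (auto intro!: integrable_bounded[where B = 1] simp: abs_square_le_1)
  have "(\<integral>x. (deg x - t_edge)\<^sup>2 \<partial>M) = (\<integral>x. (deg x)\<^sup>2 - 2 * t_edge * deg x + t_edge\<^sup>2 \<partial>M)"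
    by (simp add: power2_diff algebra_simps)
  also have "\<dots> = t_path - 2 * t_edge * t_edge + t_edge\<^sup>2"
    using i by (simp add: t_path_def t_edge_def prob_space)
  also have "\<dots> = 0"
    using assms by (simp add: power2_eq_square)
  finally have "(\<integral>x. (deg x - t_edge)\<^sup>2 \<partial>M) = 0" .
  moreover have "integrable M (\<lambda>x. (deg x - t_edge)\<^sup>2)"
    using i by (simp add: power2_diff)
  ultimately have "AE x in M. (deg x - t_edge)\<^sup>2 = 0"
    by (subst (asm) integral_nonneg_eq_0_iff_AE) auto
  then show ?thesis by auto
qed

lemma AE_triangle_free:
  assumes "t_C3 = 0"
  shows "AE x in M. AE y in M. U x y = 0 \<or> codeg x y = 0"
proof -
  have "AE x in M. AE y in M. U x y * codeg x y = 0"
  proof (rule AE_eq_0_of_double_integral)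
    show "\<bar>U x y * codeg x y\<bar> \<le> 1" for x y
      using abs_kernel[of x y] abs_codeg[of x y] by (simp add: abs_mult mult_le_one)
  qed (use assms in \<open>auto simp: t_C3_def kernel_nonneg codeg_nonneg\<close>)
  then show ?thesis by simp
qed

end

section \<open>Regular kernels: rigidity at the cycle densities of the bipartite graphon\<close>

locale regular_kernel = edge_kernel +
  fixes d :: real
  assumes deg_eq: "AE x in M. deg x = d"
begin

lemma t_edge_eq: "t_edge = d"
proof -
  have "t_edge = (\<integral>x. d \<partial>M)"
    unfolding t_edge_def using deg_eq by (intro integral_cong_AE) auto
  then show ?thesis by (simp add: prob_space)
qed

lemma d_nonneg: "0 \<le> d" and d_le_1: "d \<le> 1"
  using integral_le_1[of deg] deg_nonneg deg_le_1
  by (auto simp flip: t_edge_eq simp: t_edge_def)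

text \<open>Integrating over the endpoint \<open>y\<close> first replaces \<open>U y z\<close> by
  \<open>deg z = d\<close>; the remaining integral is \<open>d * deg x\<close>.\<close>

lemma integral_codeg: "AE x in M. (\<integral>y. codeg x y \<partial>M) = d\<^sup>2"
  using deg_eq AE_space
proof eventually_elim
  case (elim x)
  note [measurable] = elim(2)
  have "(\<integral>y. codeg x y \<partial>M) = (\<integral>y. \<integral>z. U x z * U y z \<partial>M \<partial>M)"
    by (simp add: codeg_def)
  also have "\<dots> = (\<integral>z. \<integral>y. U x z * U y z \<partial>M \<partial>M)"
    by (intro Fubini_bounded[where B = 1]) (auto simp: abs_mult abs_kernel mult_le_one)
  also have "\<dots> = (\<integral>z. U x z * deg z \<partial>M)"
    by (simp add: deg_def kernel_sym[of _ z for z])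
  also have "\<dots> = (\<integral>z. U x z * d \<partial>M)"
    using deg_eq by (intro integral_cong_AE) auto
  also have "\<dots> = d\<^sup>2"
    using elim(1) by (simp add: deg_def power2_eq_square)
  finally show ?case .
qed

text \<open>The integral of \<open>U x y * (codeg x z + codeg y z - 2 d\<^sup>2)\<^sup>2\<close> is
  \<open>2 d t_C4 + 2 t_C5 - 4 d^5 = 0\<close>; it is twice the trace of the positive operator
  \<open>V\<^sup>2 (V + d) V\<^sup>2\<close>, where \<open>V\<close> is the integral operator of \<open>U - d\<close>.\<close>

lemma AE_edge_codeg:
  assumes C4: "t_C4 = 2 * d ^ 4" and C5: "t_C5 = 0"
  shows "AE x in M. AE y in M. AE z in M. U x y * (codeg x z + codeg y z - 2 * d\<^sup>2) = 0"
proof -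
  let ?q = "\<lambda>x. \<integral>z. (codeg x z)\<^sup>2 \<partial>M"
  let ?r = "\<lambda>x y. \<integral>z. codeg x z * codeg y z \<partial>M"
  let ?s = "\<lambda>x. \<integral>z. codeg x z \<partial>M"
  let ?G = "\<lambda>x y z. codeg x z + codeg y z - 2 * d\<^sup>2"
  let ?D = "\<lambda>x y. \<integral>z. U x y * (?G x y z)\<^sup>2 \<partial>M"
  have q_bd: "0 \<le> ?q x" "?q x \<le> 1" for x
    using codeg_nonneg codeg_le_1 by (auto intro!: integral_le_1 power_le_one)
  have r_bd: "0 \<le> ?r x y" "?r x y \<le> 1" for x y
    using codeg_nonneg codeg_le_1 by (auto intro!: integral_le_1 mult_le_one)
  have G_bd: "\<bar>?G x y z\<bar> \<le> 2" for x y z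
    using codeg_nonneg[of x z] codeg_le_1[of x z] codeg_nonneg[of y z] codeg_le_1[of y z]
      power_le_one[OF d_nonneg d_le_1, of 2] zero_le_power2[of d] by linarith
  have G2_bd: "(?G x y z)\<^sup>2 \<le> 4" for x y z
    using abs_le_square_iff[of "?G x y z" 2] G_bd[of x z y] by simp
  have UG_bd: "\<bar>U x y * (?G x y z)\<^sup>2\<bar> \<le> 4" for x y z
  proof -
    have "\<bar>U x y\<bar> * (?G x y z)\<^sup>2 \<le> 1 * 4"
      by (intro mult_mono abs_kernel G2_bd) auto
    then show ?thesis by (simp add: abs_mult)
  qed
  have D: "?D x y = U x y * ?q x + U x y * ?q y + 2 * (U x y * ?r x y)
      + 4 * d ^ 4 * U x y - 4 * d\<^sup>2 * (U x y * ?s x) - 4 * d\<^sup>2 * (U x y * ?s y)"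
    if [measurable]: "x \<in> space M" "y \<in> space M" for x y
  proof -
    have i: "integrable M (\<lambda>z. (codeg x z)\<^sup>2)" "integrable M (\<lambda>z. (codeg y z)\<^sup>2)"
      "integrable M (\<lambda>z. codeg x z * codeg y z)" "integrable M (codeg x)" "integrable M (codeg y)"
      by (auto intro!: integrable_bounded[where B = 1] mult_le_one abs_codeg
          simp: abs_mult abs_square_le_1)
    have "(\<integral>z. (?G x y z)\<^sup>2 \<partial>M) = (\<integral>z. (codeg x z)\<^sup>2 + (codeg y z)\<^sup>2 + 2 * (codeg x z * codeg y z)
      + 4 * d ^ 4 - 4 * d\<^sup>2 * codeg x z - 4 * d\<^sup>2 * codeg y z \<partial>M)"
      by (intro Bochner_Integration.integral_cong refl) (simp add: power2_eq_square power4_eq_xxxx algebra_simps)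
    also have "\<dots> = ?q x + ?q y + 2 * ?r x y + 4 * d ^ 4 - 4 * d\<^sup>2 * ?s x - 4 * d\<^sup>2 * ?s y"
      using i by (simp add: prob_space)
    finally have e: "(\<integral>z. (?G x y z)\<^sup>2 \<partial>M) = \<dots>" .
    show ?thesis
      by (simp only: integral_mult_right_zero e) (simp add: algebra_simps)
  qed
  have Uq: "(\<integral>x. \<integral>y. U x y * ?q x \<partial>M \<partial>M) = d * t_C4"
  proof -
    have "(\<integral>x. \<integral>y. U x y * ?q x \<partial>M \<partial>M) = (\<integral>x. deg x * ?q x \<partial>M)"
      by (simp add: deg_def)
    also have "\<dots> = (\<integral>x. d * ?q x \<partial>M)"
      using deg_eq by (intro integral_cong_AE) auto
    finally show ?thesis by (simp add: t_C4_def)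
  qed
  have Us1: "AE x in M. AE y in M. U x y * ?s x = U x y * d\<^sup>2"
    using integral_codeg by eventually_elim auto
  have Us2: "AE x in M. AE y in M. U x y * ?s y = U x y * d\<^sup>2"
  proof (rule AE_I2)
    show "AE y in M. U x y * ?s y = U x y * d\<^sup>2" for x
      using integral_codeg by eventually_elim auto
  qed
  \<comment> \<open>Both terms with \<open>?s\<close> become \<open>- 4 * d ^ 4 * U x y\<close>;
    together with the positive term in \<open>D\<close> exactly one of them survives.\<close>
  have D': "AE x in M. AE y in M. ?D x y = U x y * ?q x + U x y * ?q y + 2 * (U x y * ?r x y) - 4 * d ^ 4 * U x y"
    using Us1 Us2 AE_space
  proof eventually_elim
    case (elim x)
    note x = elim(3)
    from elim(1,2) AE_space show ?case
    proof eventually_elim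
      case (elim y)
      show ?case
        by (simp only: D[OF x elim(3)] elim(1,2)) (simp add: power2_eq_square power4_eq_xxxx)
    qed
  qed
  have "(\<integral>x. \<integral>y. ?D x y \<partial>M \<partial>M) =
    (\<integral>x. \<integral>y. U x y * ?q x + U x y * ?q y + 2 * (U x y * ?r x y) - 4 * d ^ 4 * U x y \<partial>M \<partial>M)"
  proof (rule integral_cong_AE)
    show "AE x in M. (\<integral>y. ?D x y \<partial>M) =
      (\<integral>y. U x y * ?q x + U x y * ?q y + 2 * (U x y * ?r x y) - 4 * d ^ 4 * U x y \<partial>M)"
      using D' AE_space
    proof eventually_elim
      case (elim x)
      note [measurable] = elim(2)
      show ?case by (intro integral_cong_AE elim(1)) measurable
    qed
  qed measurable
  also have "\<dots> = (\<integral>x. (\<integral>y. U x y * ?q x \<partial>M) + (\<integral>y. U x y * ?q y \<partial>M)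
      + 2 * (\<integral>y. U x y * ?r x y \<partial>M) - 4 * d ^ 4 * (\<integral>y. U x y \<partial>M) \<partial>M)"
  proof (intro Bochner_Integration.integral_cong refl)
    fix x assume x [measurable]: "x \<in> space M"
    have "integrable M (\<lambda>y. U x y * ?q x)" "integrable M (\<lambda>y. U x y * ?q y)" "integrable M (\<lambda>y. U x y * ?r x y)"
      using q_bd r_bd by (auto intro!: integrable_bounded[where B = 1] mult_le_one abs_kernel simp: abs_mult)
    then show "(\<integral>y. U x y * ?q x + U x y * ?q y + 2 * (U x y * ?r x y) - 4 * d ^ 4 * U x y \<partial>M) =
       (\<integral>y. U x y * ?q x \<partial>M) + (\<integral>y. U x y * ?q y \<partial>M)
      + 2 * (\<integral>y. U x y * ?r x y \<partial>M) - 4 * d ^ 4 * (\<integral>y. U x y \<partial>M)"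
      using integrable_kernel[OF x] by simp
  qed
  also have "\<dots> = (\<integral>x. \<integral>y. U x y * ?q x \<partial>M \<partial>M) + (\<integral>x. \<integral>y. U x y * ?q y \<partial>M \<partial>M) + 2 * t_C5 - 4 * d ^ 4 * t_edge"
  proof -
    have i: "integrable M (\<lambda>x. \<integral>y. f x y \<partial>M)"
      if [measurable]: "(\<lambda>(x, y). f x y) \<in> borel_measurable (M \<Otimes>\<^sub>M M)"
        and "\<And>x y. 0 \<le> f x y" "\<And>x y. f x y \<le> 1" for f :: "'a \<Rightarrow> 'a \<Rightarrow> real"
    proof (rule integrable_bounded[where B = 1])
      show "\<bar>\<integral>y. f x y \<partial>M\<bar> \<le> 1" for x
        using that(2,3) by (subst abs_of_nonneg) (auto intro: integral_le_1)
    qed measurable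
    have "integrable M (\<lambda>x. \<integral>y. U x y * ?q x \<partial>M)" "integrable M (\<lambda>x. \<integral>y. U x y * ?q y \<partial>M)"
      "integrable M (\<lambda>x. \<integral>y. U x y * ?r x y \<partial>M)" "integrable M (\<lambda>x. \<integral>y. U x y \<partial>M)"
      by (rule i; (intro mult_nonneg_nonneg mult_le_one q_bd r_bd kernel_nonneg kernel_le_1)?; measurable)+
    then show ?thesis
      by (simp add: t_C5_def t_edge_def deg_def)
  qed
  \<comment> \<open>Exchanging \<open>x\<close> and \<open>y\<close> shows that both terms with
    \<open>?q\<close> contribute \<open>d * t_C4\<close>.\<close>
  also have "(\<integral>x. \<integral>y. U x y * ?q y \<partial>M \<partial>M) = (\<integral>x. \<integral>y. U x y * ?q x \<partial>M \<partial>M)"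
    using q_bd by (subst Fubini_bounded[where B = 1]) (auto simp: kernel_sym abs_mult mult_le_one abs_kernel)
  \<comment> \<open>The total is \<open>2 * d * t_C4 + 2 * t_C5 - 4 * d ^ 5\<close>, where the first
    term equals \<open>4 * d ^ 5\<close> and the second is 0.\<close>
  finally have "(\<integral>x. \<integral>y. ?D x y \<partial>M \<partial>M) = 0"
    unfolding Uq C4 C5 t_edge_eq by (simp add: power4_eq_xxxx)
  then have "AE x in M. AE y in M. ?D x y = 0"
  proof (rule AE_eq_0_of_double_integral[rotated -1])
    show "\<bar>?D x y\<bar> \<le> 4" for x y
      by (rule abs_integral_le) (rule UG_bd)
  qed (auto simp: kernel_nonneg)
  then show ?thesis
    using AE_space
  proof eventually_elim
    case (elim x)
    from elim(1) AE_space show ?case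
    proof eventually_elim
      case (elim y)
      note [measurable] = \<open>x \<in> space M\<close> \<open>y \<in> space M\<close>
      have "integrable M (\<lambda>z. U x y * (?G x y z)\<^sup>2)"
        by (rule integrable_bounded[OF _ UG_bd]) measurable
      then have "AE z in M. U x y * (?G x y z)\<^sup>2 = 0"
        using elim(1) by (subst (asm) integral_nonneg_eq_0_iff_AE) (auto simp: kernel_nonneg)
      then show ?case by simp
    qed
  qed
qed

text \<open>Where \<open>U x y\<close> is nonzero, \<open>codeg y z\<close> equals
  \<open>2 * d^2 - codeg x z\<close>, which does not depend on \<open>y\<close>; integrating with
  the weights \<open>U x y\<close>, of total mass \<open>d\<close>, gives the claim. In operator
  terms, the kernel of \<open>U^3 + d U^2\<close> is constant almost everywhere.\<close>

lemma AE_kernel_codeg: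
  assumes C4: "t_C4 = 2 * d ^ 4" and C5: "t_C5 = 0"
  shows "AE x in M. AE z in M. (\<integral>y. U x y * codeg y z \<partial>M) = 2 * d ^ 3 - d * codeg x z"
  using AE_edge_codeg[OF assms] deg_eq AE_space
proof eventually_elim
  case (elim x)
  note [measurable] = \<open>x \<in> space M\<close>
  \<comment> \<open>The quantifiers are exchanged so that \<open>z\<close> can be fixed before the
    integration over \<open>y\<close>.\<close>
  have "AE z in M. AE y in M. U x y * (codeg x z + codeg y z - 2 * d\<^sup>2) = 0"
    using elim(1) by (subst P.AE_commute[symmetric]) auto
  then show ?case using AE_space
  proof eventually_elim
    case (elim z)
    note [measurable] = \<open>z \<in> space M\<close>
    have "(\<integral>y. U x y * codeg y z \<partial>M) = (\<integral>y. (2 * d\<^sup>2 - codeg x z) * U x y \<partial>M)"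
      using elim(1) by (intro integral_cong_AE) (auto elim!: eventually_mono simp: algebra_simps)
    also have "\<dots> = (2 * d\<^sup>2 - codeg x z) * deg x"
      by (simp add: deg_def)
    finally show ?case
      using \<open>deg x = d\<close> by (simp add: algebra_simps power2_eq_square power3_eq_cube)
  qed
qed

text \<open>With \<open>V\<close> the operator of \<open>U - d\<close>, the kernel \<open>g\<close> below is that of \<open>V\<^sup>2 + d V\<close>, and
  the preceding lemma gives \<open>V g = 0\<close>, hence \<open>g\<^sup>2 = 0\<close> as an operator. Since that identity holds only
  almost everywhere, it says nothing about the diagonal, i.e. about the Hilbert-Schmidt norm of
  \<open>g\<close>. Instead we evaluate \<open>g\<close> on indicator functions: \<open>\<parallel>g f\<parallel>\<^sup>2 = \<langle>f, g\<^sup>2 f\<rangle> = 0\<close>.\<close>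

lemma AE_codeg_eq:
  assumes d: "0 < d" and C4: "t_C4 = 2 * d ^ 4" and C5: "t_C5 = 0"
  shows "AE x in M. AE y in M. codeg x y = 2 * d\<^sup>2 - d * U x y"
proof -
  let ?g = "\<lambda>x y. codeg x y + d * U x y - 2 * d\<^sup>2"
  have g_sym: "?g x y = ?g y x" for x y
    by (simp add: codeg_sym kernel_sym)
  have h_bd: "0 \<le> codeg x y + d * U x y" "codeg x y + d * U x y \<le> 2" for x y
    using codeg_nonneg[of x y] codeg_le_1[of x y] kernel_nonneg[of x y] kernel_le_1[of x y]
      d_le_1 d_nonneg mult_le_one[of d "U x y"] mult_nonneg_nonneg[of d "U x y"] by linarith+
  have g_bd: "\<bar>?g x y\<bar> \<le> 2" for x y
    using h_bd[of x y] power_le_one[OF d_nonneg d_le_1, of 2] zero_le_power2[of d] by linarith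
  have i1: "integrable M f" if "f \<in> borel_measurable M" "\<And>x. \<bar>f x\<bar> \<le> 2" for f :: "'a \<Rightarrow> real"
    using that by (rule integrable_bounded)
  \<comment> \<open>Applying \<open>U\<close> turns the three terms of \<open>?g\<close> into
    \<open>2 * d ^ 3 - d * codeg x z\<close>, \<open>d * codeg x z\<close> and
    \<open>- 2 * d ^ 3\<close>, which cancel.\<close>
  have Ug: "AE x in M. AE z in M. (\<integral>y. U x y * ?g y z \<partial>M) = 0"
    using AE_kernel_codeg[OF C4 C5] deg_eq AE_space
  proof eventually_elim
    case (elim x)
    note [measurable] = \<open>x \<in> space M\<close>
    from elim(1) AE_space show ?case
    proof eventually_elim
      case (elim z)
      note [measurable] = \<open>z \<in> space M\<close>
      have "integrable M (\<lambda>y. U x y * codeg y z)" "integrable M (\<lambda>y. U x y * U z y)" 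
        by (auto intro!: integrable_bounded[where B = 1] mult_le_one abs_kernel abs_codeg simp: abs_mult)
      moreover have "(\<integral>y. U x y * U z y \<partial>M) = codeg x z"
        by (simp add: codeg_def)
      ultimately have "(\<integral>y. U x y * codeg y z + d * (U x y * U z y) - 2 * d\<^sup>2 * U x y \<partial>M)
        = 2 * d ^ 3 - d * codeg x z + d * codeg x z - 2 * d\<^sup>2 * deg x"
        using \<open>x \<in> space M\<close> by (simp add: elim(1) deg_def)
      then show ?case
        using \<open>deg x = d\<close> by (simp add: algebra_simps power2_eq_square power3_eq_cube kernel_sym[of _ z])
    qed
  qed
  have int_g: "AE y in M. (\<integral>x. ?g x y \<partial>M) = 0"
    using integral_codeg deg_eq AE_space
  proof eventually_elim
    case (elim y)
    note [measurable] = \<open>y \<in> space M\<close>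
    have "integrable M (codeg y)" "integrable M (U y)"
      by (auto intro!: integrable_bounded[where B = 1] abs_codeg abs_kernel)
    then have "(\<integral>x. codeg y x + d * U y x - 2 * d\<^sup>2 \<partial>M) = d\<^sup>2 + d * deg y - 2 * d\<^sup>2"
      using elim by (simp add: deg_def prob_space)
    then show ?case
      using elim by (simp add: codeg_sym[of _ y] kernel_sym[of _ y] power2_eq_square)
  qed
  \<comment> \<open>\<open>?F\<close> is the operator of \<open>?g\<close> applied to the indicator
    of \<open>T\<close>. Both the image of \<open>?F\<close> under \<open>U\<close> and the integral
    of \<open>?F\<close> vanish, and \<open>?g\<close> is built from \<open>U^2\<close>,
    \<open>U\<close> and a constant, so \<open>?g\<close> maps \<open>?F\<close> to 0. The squared
    norm of \<open>?F\<close> is the pairing of the indicator with that image, hence 0.\<close>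
  have Tg: "AE x in M. (\<integral>y. indicator T y * ?g x y \<partial>M) = 0" if [measurable]: "T \<in> sets M" for T
  proof -
    let ?f = "indicator T :: 'a \<Rightarrow> real"
    let ?F = "\<lambda>x. \<integral>y. ?f y * ?g x y \<partial>M"
    have fg_bd: "\<bar>?f y * ?g x y\<bar> \<le> 2" for x y
      using g_bd by (auto simp: indicator_def)
    have F_bd: "\<bar>?F x\<bar> \<le> 2" if [measurable]: "x \<in> space M" for x
      using fg_bd by (intro abs_integral_le) auto
    have F_bd': "AE x in M. norm (?F x) \<le> 2"
      using F_bd by (intro AE_I2) simp
    have UF: "AE x in M. (\<integral>y. U x y * ?F y \<partial>M) = 0"
      using Ug AE_space
    proof eventually_elim
      case (elim x)
      note [measurable] = \<open>x \<in> space M\<close>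
      have "(\<integral>y. U x y * ?F y \<partial>M) = (\<integral>y. \<integral>w. U x y * (?f w * ?g y w) \<partial>M \<partial>M)"
        by simp
      also have "\<dots> = (\<integral>w. \<integral>y. U x y * (?f w * ?g y w) \<partial>M \<partial>M)"
        using mult_mono[OF abs_kernel fg_bd] by (intro Fubini_bounded[where B = 2]) (auto simp: abs_mult)
      also have "\<dots> = (\<integral>w. ?f w * (\<integral>y. U x y * ?g y w \<partial>M) \<partial>M)"
        by (simp add: mult.left_commute flip: integral_mult_right_zero)
      also have "\<dots> = (\<integral>w. 0 \<partial>M)"
        using elim(1) by (intro integral_cong_AE) auto
      finally show ?case by simp
    qed
    have F0: "(\<integral>x. ?F x \<partial>M) = 0"
    proof -
      have "(\<integral>x. ?F x \<partial>M) = (\<integral>y. \<integral>x. ?f y * ?g x y \<partial>M \<partial>M)"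
        using fg_bd by (intro Fubini_bounded[where B = 2]) auto
      also have "\<dots> = (\<integral>y. ?f y * (\<integral>x. ?g x y \<partial>M) \<partial>M)"
        by (simp only: integral_mult_right_zero)
      also have "\<dots> = (\<integral>y. 0 \<partial>M)"
        using int_g by (intro integral_cong_AE) auto
      finally show ?thesis by simp
    qed
    have gF: "AE y in M. (\<integral>x. ?g y x * ?F x \<partial>M) = 0"
      using UF AE_space
    proof eventually_elim
      case (elim y)
      note [measurable] = \<open>y \<in> space M\<close>
      have F_bd1: "\<bar>u * ?F x\<bar> \<le> 2" if "\<bar>u\<bar> \<le> 1" "x \<in> space M" for u x
        using mult_mono[OF that(1) F_bd[OF that(2)]] by (simp add: abs_mult)
      have "(\<integral>x. codeg y x * ?F x \<partial>M) = (\<integral>x. \<integral>w. U y w * (U x w * ?F x) \<partial>M \<partial>M)"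
        by (simp add: codeg_def mult.assoc flip: integral_mult_left_zero)
      also have "\<dots> = (\<integral>w. \<integral>x. U y w * (U x w * ?F x) \<partial>M \<partial>M)"
      proof (rule P.Fubini_integral[symmetric])
        have "AE z in M \<Otimes>\<^sub>M M. norm (case z of (x, w) \<Rightarrow> U y w * (U x w * ?F x)) \<le> 2"
        proof (rule AE_I2)
          fix z assume "z \<in> space (M \<Otimes>\<^sub>M M)"
          then show "norm (case z of (x, w) \<Rightarrow> U y w * (U x w * ?F x)) \<le> 2"
            using F_bd1[of "U y (snd z) * U (fst z) (snd z)" "fst z"]
            by (auto simp: abs_mult abs_kernel mult_le_one space_pair_measure mult.assoc)
        qed
        then show "integrable (M \<Otimes>\<^sub>M M) (\<lambda>(x, w). U y w * (U x w * ?F x))"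
          by (intro P.integrable_const_bound[where B = 2]) auto
      qed
      also have "\<dots> = (\<integral>w. U y w * (\<integral>x. U w x * ?F x \<partial>M) \<partial>M)"
        by (simp add: kernel_sym)
      also have "\<dots> = (\<integral>w. 0 \<partial>M)"
        using UF by (intro integral_cong_AE) auto
      finally have c: "(\<integral>x. codeg y x * ?F x \<partial>M) = 0" by simp
      have "integrable M (\<lambda>x. codeg y x * ?F x)" "integrable M (\<lambda>x. U y x * ?F x)" "integrable M ?F"
        using F_bd1[OF abs_codeg] F_bd1[OF abs_kernel] F_bd
        by (auto intro!: integrable_const_bound[where B = 2] AE_I2)
      then have "(\<integral>x. codeg y x * ?F x + d * (U y x * ?F x) - 2 * d\<^sup>2 * ?F x \<partial>M) = 0"
        by (simp add: c elim F0)
      then show ?case by (simp add: algebra_simps)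
    qed
    have "(\<integral>x. ?F x * ?F x \<partial>M) = (\<integral>x. \<integral>y. ?F x * (?f y * ?g x y) \<partial>M \<partial>M)"
      by simp
    also have "\<dots> = (\<integral>y. \<integral>x. ?F x * (?f y * ?g x y) \<partial>M \<partial>M)"
    proof (rule P.Fubini_integral[symmetric])
      have "AE z in M \<Otimes>\<^sub>M M. norm (case z of (x, y) \<Rightarrow> ?F x * (?f y * ?g x y)) \<le> 4"
      proof (rule AE_I2)
        fix z assume "z \<in> space (M \<Otimes>\<^sub>M M)"
        then show "norm (case z of (x, y) \<Rightarrow> ?F x * (?f y * ?g x y)) \<le> 4"
          using mult_mono[OF F_bd[of "fst z"] fg_bd[of "snd z" "fst z"]]
          by (auto simp: abs_mult space_pair_measure)
      qed
      then show "integrable (M \<Otimes>\<^sub>M M) (\<lambda>(x, y). ?F x * (?f y * ?g x y))"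
        by (intro P.integrable_const_bound[where B = 4]) auto
    qed
    also have "\<dots> = (\<integral>y. ?f y * (\<integral>x. ?g y x * ?F x \<partial>M) \<partial>M)"
    proof (rule Bochner_Integration.integral_cong[OF refl])
      fix y
      have "(\<integral>x. ?F x * (?f y * ?g x y) \<partial>M) = (\<integral>x. ?f y * (?g y x * ?F x) \<partial>M)"
        by (simp only: g_sym[of _ y] mult_ac)
      then show "(\<integral>x. ?F x * (?f y * ?g x y) \<partial>M) = ?f y * (\<integral>x. ?g y x * ?F x \<partial>M)"
        by (simp only: integral_mult_right_zero)
    qed
    also have "\<dots> = (\<integral>y. 0 \<partial>M)"
      using gF by (intro integral_cong_AE) auto
    finally have "(\<integral>x. ?F x * ?F x \<partial>M) = 0" by simp
    moreover have "integrable M (\<lambda>x. ?F x * ?F x)"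
    proof (intro integrable_const_bound[where B = 4] AE_I2)
      fix x assume "x \<in> space M"
      then have "\<bar>?F x\<bar> * \<bar>?F x\<bar> \<le> 2 * 2"
        by (intro mult_mono F_bd) auto
      then show "norm (?F x * ?F x) \<le> 4"
        by (simp only: real_norm_def abs_mult)
    qed auto
    ultimately have "AE x in M. ?F x * ?F x = 0"
      by (subst (asm) integral_nonneg_eq_0_iff_AE) auto
    then show ?thesis by simp
  qed
  \<comment> \<open>The kernel \<open>?g\<close> need not be nonnegative, so its constant is moved
    to the right-hand side; this gives the nonnegative kernel and the positive constant that the
    density argument requires.\<close>
  have "AE x in M. AE y in M. codeg x y + d * U x y = 2 * d\<^sup>2"
  proof (rule AE_const_of_rectangle_integrals)
    fix S T assume [measurable]: "S \<in> sets M" "T \<in> sets M"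
    have "(\<integral>x. \<integral>y. indicator S x * indicator T y * (codeg x y + d * U x y) \<partial>M \<partial>M)
      = (\<integral>x. indicator S x * (2 * d\<^sup>2 * prob T) \<partial>M)"
    proof (rule integral_cong_AE)
      show "AE x in M. (\<integral>y. indicator S x * indicator T y * (codeg x y + d * U x y) \<partial>M)
          = indicator S x * (2 * d\<^sup>2 * prob T)"
        using Tg[OF \<open>T \<in> sets M\<close>] AE_space
      proof eventually_elim
        case (elim x)
        note [measurable] = \<open>x \<in> space M\<close>
        have "integrable M (\<lambda>y. indicator T y * ?g x y)"
          using g_bd by (intro i1) (auto simp: indicator_def)
        moreover have "integrable M (\<lambda>y. indicator T y * (2 * d\<^sup>2))"
          by (intro integrable_bounded[where B = "2 * d\<^sup>2"]) (auto simp: indicator_def)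
        ultimately have "(\<integral>y. indicator T y * ?g x y + indicator T y * (2 * d\<^sup>2) \<partial>M) = 2 * d\<^sup>2 * prob T"
          using elim(1) by (subst Bochner_Integration.integral_add) auto
        then show ?case
          by (simp add: mult.assoc distrib_left[symmetric])
      qed
    qed auto
    then show "(\<integral>x. \<integral>y. indicator S x * indicator T y * (codeg x y + d * U x y) \<partial>M \<partial>M)
      = 2 * d\<^sup>2 * prob S * prob T" by simp
  qed (use h_bd d in \<open>auto simp: abs_le_iff intro: order_trans[OF _ h_bd(1)]\<close>)
  then show ?thesis
    by (auto elim!: eventually_mono simp: algebra_simps)
qed

text \<open>Take \<open>S\<close> to be the neighbourhood of a typical \<open>z\<close>. As a
  function of \<open>y\<close>, \<open>codeg y z\<close> is 0 on \<open>S\<close> and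
  \<open>2 * d^2\<close> off \<open>S\<close>, and the identity for the integral of
  \<open>U x y * codeg y z\<close> puts it at one of its two extreme values. Hence almost all
  neighbours of \<open>x\<close> lie on the side opposite to \<open>x\<close>, and the degree
  \<open>d\<close> then leaves no room for missing pairs.\<close>

lemma AE_two_block:
  assumes d: "0 < d" and C3: "t_C3 = 0" and C4: "t_C4 = 2 * d ^ 4" and C5: "t_C5 = 0"
  shows "\<exists>S\<in>sets M. prob S = 1 / 2 \<and> (AE x in M. AE y in M. U x y = (if (x \<in> S) \<noteq> (y \<in> S) then 2 * d else 0))"
proof -
  \<comment> \<open>Substituting \<open>codeg x y = 2 * d^2 - d * U x y\<close> into
    \<open>U x y * codeg x y = 0\<close> leaves the roots 0 and \<open>2 * d\<close> for
    \<open>U x y\<close>.\<close>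
  have two_valued: "AE x in M. AE y in M. (U x y = 0 \<and> codeg x y = 2 * d\<^sup>2) \<or> (U x y = 2 * d \<and> codeg x y = 0)"
    using AE_codeg_eq[OF d C4 C5] AE_triangle_free[OF C3]
  proof eventually_elim
    case (elim x)
    then show ?case
      by eventually_elim (use d in \<open>auto simp: power2_eq_square\<close>)
  qed
  \<comment> \<open>With the quantifiers exchanged, a single \<open>z\<close> can be chosen for
    which the identity holds for almost all \<open>x\<close>.\<close>
  have "AE z in M. AE x in M. (\<integral>y. U x y * codeg y z \<partial>M) = 2 * d ^ 3 - d * codeg x z"
    using AE_kernel_codeg[OF C4 C5] by (subst P.AE_commute[symmetric]) auto
  with two_valued deg_eq AE_space have "AE z in M. z \<in> space M \<and> deg z = d \<and>
    (AE y in M. (U z y = 0 \<and> codeg z y = 2 * d\<^sup>2) \<or> (U z y = 2 * d \<and> codeg z y = 0)) \<and>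
    (AE x in M. (\<integral>y. U x y * codeg y z \<partial>M) = 2 * d ^ 3 - d * codeg x z)"
    by eventually_elim auto
  then obtain z where [measurable]: "z \<in> space M" and deg_z: "deg z = d"
    and Uz: "AE y in M. (U z y = 0 \<and> codeg z y = 2 * d\<^sup>2) \<or> (U z y = 2 * d \<and> codeg z y = 0)"
    and z: "AE x in M. (\<integral>y. U x y * codeg y z \<partial>M) = 2 * d ^ 3 - d * codeg x z"
    by (blast dest: AE_imp_ex)
  define S where "S = {y \<in> space M. U z y \<noteq> 0}"
  have S [measurable]: "S \<in> sets M" unfolding S_def by measurable
  let ?K = "\<lambda>x y. if (x \<in> S) \<noteq> (y \<in> S) then 2 * d else 0"
  \<comment> \<open>Almost everywhere \<open>U z\<close> is \<open>2 * d\<close> on \<open>S\<close>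
    and 0 elsewhere, while its integral is \<open>d\<close>.\<close>
  have half: "prob S = 1 / 2"
  proof -
    have "deg z = (\<integral>y. 2 * d * indicator S y \<partial>M)"
      unfolding deg_def
    proof (rule integral_cong_AE)
      show "AE y in M. U z y = 2 * d * indicator S y"
        using Uz AE_space by eventually_elim (auto simp: S_def indicator_def)
    qed auto
    then show ?thesis using d deg_z by simp
  qed
  have K_int: "(\<integral>y. ?K x y \<partial>M) = d" for x
  proof -
    have "(\<integral>y. ?K x y \<partial>M) = (\<integral>y. (if x \<in> S then 2 * d - 2 * d * indicator S y else 2 * d * indicator S y) \<partial>M)"
      by (intro Bochner_Integration.integral_cong) auto
    moreover have "integrable M (indicator S :: 'a \<Rightarrow> real)"
      by (intro integrable_bounded[where B = 1]) (auto simp: indicator_def)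
    ultimately show ?thesis using half by (cases "x \<in> S") (auto simp: prob_space)
  qed
  have "AE x in M. AE y in M. U x y = ?K x y"
    using z Uz deg_eq two_valued AE_space
  proof eventually_elim
    case (elim x)
    note [measurable] = \<open>x \<in> space M\<close>
    have iUc: "integrable M (\<lambda>y. U x y * codeg y z)"
      by (auto intro!: integrable_bounded[where B = 1] mult_le_one abs_kernel abs_codeg simp: abs_mult)
    have "AE y in M. U x y = 0 \<or> (x \<in> S) \<noteq> (y \<in> S)"
    proof (cases "x \<in> S")
      case True
      then have "codeg x z = 0" "U z x = 2 * d" using elim(2) by (auto simp: S_def codeg_sym)
      \<comment> \<open>For \<open>x\<close> in \<open>S\<close> the average of
        \<open>codeg y z\<close> with weights \<open>U x y\<close> attains the maximal value
        \<open>2 * d^2\<close>, so \<open>U x y\<close> vanishes where \<open>codeg y z = 0\<close>,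
        that is, for \<open>y\<close> in \<open>S\<close>.\<close>
      have "(\<integral>y. 2 * d\<^sup>2 * U x y - U x y * codeg y z \<partial>M) = 0"
        using iUc elim(1,3) \<open>codeg x z = 0\<close> \<open>x \<in> space M\<close>
        by (simp add: deg_def power2_eq_square power3_eq_cube)
      moreover have "AE y in M. 0 \<le> 2 * d\<^sup>2 * U x y - U x y * codeg y z"
        using Uz by eventually_elim (use d kernel_nonneg in \<open>auto simp: codeg_sym[of _ z]\<close>)
      ultimately have "AE y in M. 2 * d\<^sup>2 * U x y - U x y * codeg y z = 0"
        using iUc \<open>x \<in> space M\<close> by (subst (asm) integral_nonneg_eq_0_iff_AE) auto
      then show ?thesis using Uz AE_space
        by eventually_elim (use True d in \<open>auto simp: S_def codeg_sym[of _ z]\<close>)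
    next
      case False
      then have "codeg x z = 2 * d\<^sup>2" using elim by (auto simp: S_def codeg_sym)
      \<comment> \<open>For \<open>x\<close> outside \<open>S\<close> the weighted average is
        minimal, namely 0, so \<open>U x y\<close> vanishes for \<open>y\<close> outside
        \<open>S\<close>.\<close>
      then have "(\<integral>y. U x y * codeg y z \<partial>M) = 0"
        using elim(1) by (simp add: power2_eq_square power3_eq_cube)
      then have "AE y in M. U x y * codeg y z = 0"
        using iUc by (subst (asm) integral_nonneg_eq_0_iff_AE) (auto simp: kernel_nonneg codeg_nonneg)
      then show ?thesis using Uz AE_space
        by eventually_elim (use False d in \<open>auto simp: S_def codeg_sym[of _ z]\<close>)
    qed
    \<comment> \<open>\<open>U x\<close> is bounded by \<open>?K x\<close> almost everywhere and
      both have integral \<open>d\<close>, so they coincide almost everywhere.\<close>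
    then have le: "AE y in M. 0 \<le> ?K x y - U x y"
      using elim(4) by eventually_elim (use d in auto)
    have iK: "integrable M (\<lambda>y. ?K x y)"
      using d by (intro integrable_bounded[where B = "2 * d"]) auto
    have "(\<integral>y. ?K x y - U x y \<partial>M) = 0"
      using iK K_int[of x] elim(3) \<open>x \<in> space M\<close> by (simp add: deg_def)
    then have "AE y in M. ?K x y - U x y = 0"
      using le iK \<open>x \<in> space M\<close> by (subst (asm) integral_nonneg_eq_0_iff_AE) auto
    then show ?case by eventually_elim auto
  qed
  with S half show ?thesis by blast
qed

end

section \<open>Homomorphism densities\<close>

lemma (in prob_space) prob_space_PiM_const: "prob_space (\<Pi>\<^sub>M i\<in>I. M)"
  by (intro prob_space_PiM prob_space_axioms)

lemma (in prob_space) measurable_resample [measurable]: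
  assumes "v \<in> I"
  shows "(\<lambda>(x, y). x(v := y)) \<in> (\<Pi>\<^sub>M i\<in>I. M) \<Otimes>\<^sub>M M \<rightarrow>\<^sub>M (\<Pi>\<^sub>M i\<in>I. M)"
  unfolding split_beta using assms by (intro measurable_fun_upd[where J = I]) auto

text \<open>Redrawing one coordinate independently preserves the product measure. The index set
  stays \<open>I\<close>, so vertices can be integrated out one after another without leaving the
  space.\<close>

lemma (in prob_space) integral_PiM_resample:
  fixes f :: "('i \<Rightarrow> 'a) \<Rightarrow> real"
  assumes I: "finite I" "v \<in> I"
    and f [measurable]: "f \<in> borel_measurable (\<Pi>\<^sub>M i\<in>I. M)" and B: "\<And>x. \<bar>f x\<bar> \<le> B"
  shows "(\<integral>x. f x \<partial>(\<Pi>\<^sub>M i\<in>I. M)) = (\<integral>x. \<integral>y. f (x(v := y)) \<partial>M \<partial>(\<Pi>\<^sub>M i\<in>I. M))"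
proof -
  interpret product_sigma_finite "\<lambda>_. M" ..
  interpret I: prob_space "\<Pi>\<^sub>M i\<in>I. M" by (rule prob_space_PiM_const)
  have I': "insert v (I - {v}) = I" using I by auto
  let ?H = "\<lambda>x. \<integral>y. f (x(v := y)) \<partial>M"
  have "(\<lambda>(x, y). f (x(v := y))) \<in> borel_measurable ((\<Pi>\<^sub>M i\<in>I. M) \<Otimes>\<^sub>M M)"
    using measurable_compose[OF measurable_resample[OF I(2)] f] by (simp add: split_beta)
  then have H: "?H \<in> borel_measurable (\<Pi>\<^sub>M i\<in>I. M)"
    by measurable
  have split: "(\<integral>x. g x \<partial>(\<Pi>\<^sub>M i\<in>I. M)) = (\<integral>x. \<integral>y. g (x(v := y)) \<partial>M \<partial>(\<Pi>\<^sub>M i\<in>I - {v}. M))"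
    if "g \<in> borel_measurable (\<Pi>\<^sub>M i\<in>I. M)" "\<And>x. \<bar>g x\<bar> \<le> B" for g :: "('i \<Rightarrow> 'a) \<Rightarrow> real"
    using product_integral_insert[of "I - {v}" v g, unfolded I'] I.integrable_bounded[OF that] I
    by simp
  have "(\<integral>x. f x \<partial>(\<Pi>\<^sub>M i\<in>I. M)) = (\<integral>x. ?H x \<partial>(\<Pi>\<^sub>M i\<in>I - {v}. M))"
    by (rule split[OF f B])
  \<comment> \<open>\<open>?H\<close> ignores coordinate \<open>v\<close>, so restoring that
    coordinate does not change the integral.\<close>
  also have "\<dots> = (\<integral>x. ?H x \<partial>(\<Pi>\<^sub>M i\<in>I. M))"
    using split[OF H abs_integral_le[OF B]] by (simp add: prob_space)
  finally show ?thesis .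
qed

text \<open>The exceptional set is enclosed in a measurable null set \<open>N\<close>. Resampling
  coordinate \<open>j\<close> turns the probability of hitting \<open>N\<close> into the mean
  measure of its sections, and almost every section is null.\<close>

lemma (in prob_space) AE_PiM_pair:
  assumes I: "finite I" "i \<in> I" "j \<in> I" "i \<noteq> j"
    and P: "AE z in M \<Otimes>\<^sub>M M. P (fst z) (snd z)"
  shows "AE x in (\<Pi>\<^sub>M i\<in>I. M). P (x i) (x j)"
proof -
  interpret P: pair_prob_space M M ..
  interpret I: prob_space "\<Pi>\<^sub>M i\<in>I. M" by (rule prob_space_PiM_const)
  obtain N where N: "N \<in> null_sets (M \<Otimes>\<^sub>M M)" "{z \<in> space (M \<Otimes>\<^sub>M M). \<not> P (fst z) (snd z)} \<subseteq> N"
    using P unfolding eventually_ae_filter by auto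
  then have [measurable]: "N \<in> sets (M \<Otimes>\<^sub>M M)" by auto
  let ?f = "\<lambda>x. indicator N (x i, x j) :: real"
  have m: "?f \<in> borel_measurable (\<Pi>\<^sub>M i\<in>I. M)"
    using I by measurable
  have "AE z in M \<Otimes>\<^sub>M M. z \<notin> N" using N by (simp add: AE_not_in)
  then have "AE x in M. AE y in M. (x, y) \<notin> N" by (rule P.AE_pair)
  then have "AE x in M. (\<integral>y. indicator N (x, y) \<partial>M) = (0::real)"
    using AE_space
  proof eventually_elim
    case (elim x)
    note [measurable] = \<open>x \<in> space M\<close>
    from elim(1) have "(\<integral>y. indicator N (x, y) \<partial>M) = (\<integral>y. 0 \<partial>M :: real)"
      by (intro integral_cong_AE) auto
    then show ?case by simp
  qed
  then have "AE x in (\<Pi>\<^sub>M i\<in>I. M). (\<integral>y. indicator N (x i, y) \<partial>M) = (0::real)"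
    using I by (intro AE_PiM_component prob_space_axioms)
  then have "(\<integral>x. \<integral>y. indicator N (x i, y) \<partial>M \<partial>(\<Pi>\<^sub>M i\<in>I. M)) = (\<integral>x. 0 \<partial>(\<Pi>\<^sub>M i\<in>I. M) :: real)"
    using I by (intro integral_cong_AE) auto
  then have "(\<integral>x. ?f x \<partial>(\<Pi>\<^sub>M i\<in>I. M)) = 0"
    using I by (subst integral_PiM_resample[where v = j and B = 1, OF _ _ m]) (auto simp: indicator_def)
  then have "AE x in (\<Pi>\<^sub>M i\<in>I. M). ?f x = 0"
    using m by (subst (asm) integral_nonneg_eq_0_iff_AE)
      (auto intro!: I.integrable_bounded[where B = 1] simp: indicator_def)
  then show ?thesis using AE_space
  proof eventually_elim
    case (elim x)
    then have "(x i, x j) \<in> space (M \<Otimes>\<^sub>M M)"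
      using I by (auto simp: space_pair_measure space_PiM)
    with elim N(2) show ?case by (auto simp: indicator_def split: if_splits)
  qed
qed

context edge_kernel
begin

definition edge_weight :: "(nat \<Rightarrow> 'a) \<Rightarrow> nat set \<Rightarrow> real" where
  "edge_weight x e = U (x (Min e)) (x (Max e))"

text \<open>\<open>I\<close> is the vertex set and \<open>F\<close> the edge set. Isolated vertices
  contribute a factor 1, so all graphs on \<open>{1..5}\<close> can be compared on one product
  space.\<close>

definition hom_density :: "nat set \<Rightarrow> nat set set \<Rightarrow> real" where
  "hom_density I F = (\<integral>x. (\<Prod>e\<in>F. edge_weight x e) \<partial>(\<Pi>\<^sub>M i\<in>I. M))"

lemma edge_weight_pair: "edge_weight x {a, b} = U (x a) (x b)"
  by (cases "a \<le> b") (auto simp: edge_weight_def min_def max_def kernel_sym)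

lemma edge_weight_nonneg: "0 \<le> edge_weight x e" and edge_weight_le_1: "edge_weight x e \<le> 1"
  by (simp_all add: edge_weight_def kernel_nonneg kernel_le_1)

lemma measurable_edge_weight:
  assumes "e \<subseteq> I" "card e = 2"
  shows "(\<lambda>x. edge_weight x e) \<in> borel_measurable (\<Pi>\<^sub>M i\<in>I. M)"
proof -
  obtain a b where "e = {a, b}" using assms by (auto simp: card_2_iff)
  then show ?thesis using assms by (simp add: edge_weight_pair)
qed

lemma measurable_prod_edge_weight:
  assumes "\<And>e. e \<in> F \<Longrightarrow> e \<subseteq> I \<and> card e = 2"
  shows "(\<lambda>x. \<Prod>e\<in>F. edge_weight x e) \<in> borel_measurable (\<Pi>\<^sub>M i\<in>I. M)"
  using assms by (intro borel_measurable_prod measurable_edge_weight) auto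

lemma prod_edge_weight_bounds: "0 \<le> (\<Prod>e\<in>F. edge_weight x e)" "(\<Prod>e\<in>F. edge_weight x e) \<le> 1"
  by (auto intro: prod_nonneg prod_le_1 edge_weight_nonneg edge_weight_le_1)

lemma hom_density_nonneg: "0 \<le> hom_density I F"
  by (simp add: hom_density_def prod_edge_weight_bounds)

text \<open>Additional edges only contribute factors between 0 and 1. This makes the density of
  every graph containing a triangle vanish once \<open>t_C3\<close> does.\<close>

lemma hom_density_antimono:
  assumes "finite F" "F' \<subseteq> F" "\<And>e. e \<in> F \<Longrightarrow> e \<subseteq> I \<and> card e = 2"
  shows "hom_density I F \<le> hom_density I F'"
proof -
  interpret I: prob_space "\<Pi>\<^sub>M i\<in>I. M" by (rule prob_space_PiM_const)
  have i: "integrable (\<Pi>\<^sub>M i\<in>I. M) (\<lambda>x. \<Prod>e\<in>G. edge_weight x e)" if "G \<subseteq> F" for G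
    using assms that by (intro I.integrable_bounded[where B = 1] measurable_prod_edge_weight)
      (auto simp: prod_edge_weight_bounds)
  have "(\<Prod>e\<in>F. edge_weight x e) \<le> (\<Prod>e\<in>F'. edge_weight x e)" for x
    using assms prod_edge_weight_bounds[of x]
    by (subst prod.subset_diff[of F' F]) (auto intro: mult_left_le_one_le)
  then show ?thesis
    unfolding hom_density_def using assms by (intro integral_mono i) auto
qed

text \<open>Here and in the next lemmas vertices are resampled one at a time: the end of a single
  edge leaves a degree, and a vertex joined to two others leaves their codegree.\<close>

lemma hom_density_edge:
  assumes [simp]: "finite I" "a \<in> I" "b \<in> I" and ab [simp]: "a \<noteq> b"
  shows "hom_density I {{a, b}} = t_edge"
proof -
  interpret I: prob_space "\<Pi>\<^sub>M i\<in>I. M" by (rule prob_space_PiM_const)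
  have "hom_density I {{a, b}} = (\<integral>x. U (x a) (x b) \<partial>(\<Pi>\<^sub>M i\<in>I. M))"
    by (simp add: hom_density_def edge_weight_pair)
  also have "\<dots> = (\<integral>x. deg (x a) \<partial>(\<Pi>\<^sub>M i\<in>I. M))"
    by (subst integral_PiM_resample[where v = b and B = 1]) (auto simp: deg_def abs_kernel)
  also have "\<dots> = t_edge"
    by (subst integral_PiM_resample[where v = a and B = 1]) (auto simp: abs_deg t_edge_def I.prob_space)
  finally show ?thesis .
qed

lemma hom_density_path:
  assumes [simp]: "finite I" "a \<in> I" "b \<in> I" "c \<in> I" and "distinct [a, b, c]"
  shows "hom_density I {{a, b}, {b, c}} = t_path"
proof -
  interpret I: prob_space "\<Pi>\<^sub>M i\<in>I. M" by (rule prob_space_PiM_const)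
  have [simp]: "a \<noteq> b" "b \<noteq> a" "b \<noteq> c" "c \<noteq> b" "a \<noteq> c" "c \<noteq> a" using assms by auto
  have "hom_density I {{a, b}, {b, c}} = (\<integral>x. U (x b) (x a) * U (x b) (x c) \<partial>(\<Pi>\<^sub>M i\<in>I. M))"
    by (simp add: hom_density_def edge_weight_pair doubleton_eq_iff kernel_sym[of _ "_ b"])
  also have "\<dots> = (\<integral>x. U (x b) (x a) * deg (x b) \<partial>(\<Pi>\<^sub>M i\<in>I. M))"
    by (subst integral_PiM_resample[where v = c and B = 1]) (auto simp: deg_def abs_kernel abs_mult mult_le_one)
  also have "\<dots> = (\<integral>x. deg (x b) * deg (x b) \<partial>(\<Pi>\<^sub>M i\<in>I. M))"
    by (subst integral_PiM_resample[where v = a and B = 1])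
      (auto simp: abs_kernel abs_deg abs_mult mult_le_one simp flip: deg_def)
  also have "\<dots> = t_path"
    by (subst integral_PiM_resample[where v = b and B = 1])
      (auto simp: deg_nonneg deg_le_1 t_path_def I.prob_space power2_eq_square mult_le_one)
  finally show ?thesis .
qed

lemma hom_density_two_edges:
  assumes [simp]: "finite I" "a \<in> I" "b \<in> I" "c \<in> I" "d \<in> I" and "distinct [a, b, c, d]"
  shows "hom_density I {{a, b}, {c, d}} = t_edge\<^sup>2"
proof -
  interpret I: prob_space "\<Pi>\<^sub>M i\<in>I. M" by (rule prob_space_PiM_const)
  have [simp]: "a \<noteq> b" "b \<noteq> a" "b \<noteq> c" "c \<noteq> b" "a \<noteq> c" "c \<noteq> a" "a \<noteq> d" "d \<noteq> a"
    "b \<noteq> d" "d \<noteq> b" "c \<noteq> d" "d \<noteq> c" using assms by auto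
  have "hom_density I {{a, b}, {c, d}} = (\<integral>x. U (x a) (x b) * U (x c) (x d) \<partial>(\<Pi>\<^sub>M i\<in>I. M))"
    by (simp add: hom_density_def edge_weight_pair doubleton_eq_iff)
  also have "\<dots> = (\<integral>x. U (x a) (x b) * deg (x c) \<partial>(\<Pi>\<^sub>M i\<in>I. M))"
    by (subst integral_PiM_resample[where v = d and B = 1]) (auto simp: deg_def abs_kernel abs_mult mult_le_one)
  also have "\<dots> = (\<integral>x. U (x a) (x b) * t_edge \<partial>(\<Pi>\<^sub>M i\<in>I. M))"
    by (subst integral_PiM_resample[where v = c and B = 1])
      (auto simp: t_edge_def abs_kernel abs_deg abs_mult mult_le_one)
  also have "\<dots> = hom_density I {{a, b}} * t_edge"
    by (simp add: hom_density_def edge_weight_pair)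
  finally show ?thesis by (simp add: hom_density_edge power2_eq_square)
qed

lemma hom_density_C3:
  assumes [simp]: "finite I" "a \<in> I" "b \<in> I" "c \<in> I" and "distinct [a, b, c]"
  shows "hom_density I {{a, b}, {b, c}, {c, a}} = t_C3"
proof -
  interpret I: prob_space "\<Pi>\<^sub>M i\<in>I. M" by (rule prob_space_PiM_const)
  have [simp]: "a \<noteq> b" "b \<noteq> a" "b \<noteq> c" "c \<noteq> b" "a \<noteq> c" "c \<noteq> a" using assms by auto
  have "hom_density I {{a, b}, {b, c}, {c, a}} =
      (\<integral>x. U (x a) (x b) * (U (x a) (x c) * U (x b) (x c)) \<partial>(\<Pi>\<^sub>M i\<in>I. M))"
    by (simp add: hom_density_def edge_weight_pair doubleton_eq_iff kernel_sym[of "_ c"] mult_ac)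
  also have "\<dots> = (\<integral>x. U (x a) (x b) * codeg (x a) (x b) \<partial>(\<Pi>\<^sub>M i\<in>I. M))"
    by (subst integral_PiM_resample[where v = c and B = 1]) (auto simp: codeg_def abs_kernel abs_mult mult_le_one)
  also have "\<dots> = (\<integral>x. \<integral>y. U (x a) y * codeg (x a) y \<partial>M \<partial>(\<Pi>\<^sub>M i\<in>I. M))"
    by (subst integral_PiM_resample[where v = b and B = 1])
      (auto simp: abs_kernel abs_codeg abs_mult mult_le_one)
  also have "\<dots> = t_C3"
    by (subst integral_PiM_resample[where v = a and B = 1])
      (auto simp: t_C3_def I.prob_space abs_kernel abs_codeg abs_mult mult_le_one intro!: abs_integral_le)
  finally show ?thesis .
qed

text \<open>\<open>b\<close> and \<open>d\<close> are common neighbours of the opposite vertices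
  \<open>a\<close> and \<open>c\<close>; integrating both out leaves the square of one
  codegree.\<close>

lemma hom_density_C4:
  assumes [simp]: "finite I" "a \<in> I" "b \<in> I" "c \<in> I" "d \<in> I" and "distinct [a, b, c, d]"
  shows "hom_density I {{a, b}, {b, c}, {c, d}, {d, a}} = t_C4"
proof -
  interpret I: prob_space "\<Pi>\<^sub>M i\<in>I. M" by (rule prob_space_PiM_const)
  have [simp]: "a \<noteq> b" "b \<noteq> a" "b \<noteq> c" "c \<noteq> b" "a \<noteq> c" "c \<noteq> a" "a \<noteq> d" "d \<noteq> a"
    "b \<noteq> d" "d \<noteq> b" "c \<noteq> d" "d \<noteq> c" using assms by auto
  have "hom_density I {{a, b}, {b, c}, {c, d}, {d, a}} =
      (\<integral>x. (U (x a) (x b) * U (x c) (x b)) * (U (x a) (x d) * U (x c) (x d)) \<partial>(\<Pi>\<^sub>M i\<in>I. M))"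
    by (simp add: hom_density_def edge_weight_pair doubleton_eq_iff kernel_sym[of "_ d"] kernel_sym[of "_ b" "_ c"] mult_ac)
  also have "\<dots> = (\<integral>x. (U (x a) (x b) * U (x c) (x b)) * codeg (x a) (x c) \<partial>(\<Pi>\<^sub>M i\<in>I. M))"
    by (subst integral_PiM_resample[where v = d and B = 1]) (auto simp: codeg_def abs_kernel abs_mult mult_le_one)
  also have "\<dots> = (\<integral>x. codeg (x a) (x c) * codeg (x a) (x c) \<partial>(\<Pi>\<^sub>M i\<in>I. M))"
    by (subst integral_PiM_resample[where v = b and B = 1])
      (auto simp: abs_kernel abs_codeg abs_mult mult_le_one simp flip: codeg_def)
  also have "\<dots> = (\<integral>x. \<integral>y. codeg (x a) y * codeg (x a) y \<partial>M \<partial>(\<Pi>\<^sub>M i\<in>I. M))"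
    by (subst integral_PiM_resample[where v = c and B = 1])
      (auto simp: codeg_nonneg codeg_le_1 mult_le_one)
  also have "\<dots> = t_C4"
    by (subst integral_PiM_resample[where v = a and B = 1])
      (auto simp: t_C4_def power2_eq_square I.prob_space codeg_nonneg codeg_le_1 mult_le_one intro!: integral_le_1)
  finally show ?thesis .
qed

text \<open>\<open>e\<close> and \<open>c\<close> are integrated out first, as common neighbours of
  \<open>a\<close>, \<open>d\<close> and of \<open>b\<close>, \<open>d\<close>. Then
  \<open>d\<close> becomes the inner variable \<open>z\<close> of \<open>t_C5\<close>, and the edge
  between \<open>a\<close> and \<open>b\<close> remains.\<close>

lemma hom_density_C5:
  assumes [simp]: "finite I" "a \<in> I" "b \<in> I" "c \<in> I" "d \<in> I" "e \<in> I" and "distinct [a, b, c, d, e]"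
  shows "hom_density I {{a, b}, {b, c}, {c, d}, {d, e}, {e, a}} = t_C5"
proof -
  interpret I: prob_space "\<Pi>\<^sub>M i\<in>I. M" by (rule prob_space_PiM_const)
  have [simp]: "a \<noteq> b" "b \<noteq> a" "b \<noteq> c" "c \<noteq> b" "a \<noteq> c" "c \<noteq> a" "a \<noteq> d" "d \<noteq> a"
    "b \<noteq> d" "d \<noteq> b" "c \<noteq> d" "d \<noteq> c" "a \<noteq> e" "e \<noteq> a" "b \<noteq> e" "e \<noteq> b" "c \<noteq> e" "e \<noteq> c" "d \<noteq> e" "e \<noteq> d"
    using assms by auto
  have "hom_density I {{a, b}, {b, c}, {c, d}, {d, e}, {e, a}} =
      (\<integral>x. U (x a) (x b) * (U (x b) (x c) * U (x d) (x c)) * (U (x a) (x e) * U (x d) (x e)) \<partial>(\<Pi>\<^sub>M i\<in>I. M))"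
    by (simp add: hom_density_def edge_weight_pair doubleton_eq_iff kernel_sym[of "_ e"] kernel_sym[of "_ c" "_ d"] mult_ac)
  also have "\<dots> = (\<integral>x. U (x a) (x b) * (U (x b) (x c) * U (x d) (x c)) * codeg (x a) (x d) \<partial>(\<Pi>\<^sub>M i\<in>I. M))"
    by (subst integral_PiM_resample[where v = e and B = 1]) (auto simp: codeg_def abs_kernel abs_mult mult_le_one)
  also have "\<dots> = (\<integral>x. U (x a) (x b) * codeg (x b) (x d) * codeg (x a) (x d) \<partial>(\<Pi>\<^sub>M i\<in>I. M))"
    by (subst integral_PiM_resample[where v = c and B = 1])
      (auto simp: codeg_def[of "_ b" "_ d"] abs_kernel abs_codeg abs_mult mult_le_one)
  also have "\<dots> = (\<integral>x. U (x a) (x b) * (\<integral>z. codeg (x a) z * codeg (x b) z \<partial>M) \<partial>(\<Pi>\<^sub>M i\<in>I. M))"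
    by (subst integral_PiM_resample[where v = d and B = 1])
      (auto simp: abs_kernel abs_codeg abs_mult mult_le_one mult.assoc mult.commute[of "codeg (_ b) _"])
  also have "\<dots> = (\<integral>x. \<integral>y. U (x a) y * (\<integral>z. codeg (x a) z * codeg y z \<partial>M) \<partial>M \<partial>(\<Pi>\<^sub>M i\<in>I. M))"
    by (subst integral_PiM_resample[where v = b and B = 1])
      (auto simp: abs_kernel abs_codeg abs_mult intro!: mult_le_one abs_integral_le)
  also have "\<dots> = t_C5"
    by (subst integral_PiM_resample[where v = a and B = 1])
      (auto simp: t_C5_def I.prob_space abs_kernel abs_codeg abs_mult intro!: mult_le_one abs_integral_le)
  finally show ?thesis .
qed

end

text \<open>Only the factor of \<open>e\<close> involves the leaf \<open>v\<close>, so resampling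
  \<open>v\<close> turns this factor into the degree of the other endpoint, which is almost surely
  \<open>d\<close>.\<close>

lemma (in regular_kernel) hom_density_leaf:
  assumes I: "finite I" and F: "finite F" "\<And>e. e \<in> F \<Longrightarrow> e \<subseteq> I \<and> card e = 2"
    and e: "e \<in> F" "v \<in> e" and leaf: "\<And>e'. e' \<in> F \<Longrightarrow> v \<in> e' \<Longrightarrow> e' = e"
  shows "hom_density I F = d * hom_density I (F - {e})"
proof -
  have "card e = 2" using F(2) e by auto
  then obtain w where ew: "e = {w, v}" "w \<noteq> v" using e(2) by (auto simp: card_2_iff)
  then have [simp]: "w \<in> I" "v \<in> I" using F(2)[OF e(1)] by auto
  let ?R = "\<lambda>x. \<Prod>e\<in>F - {e}. edge_weight x e"
  have m: "?R \<in> borel_measurable (\<Pi>\<^sub>M i\<in>I. M)"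
    using F by (intro measurable_prod_edge_weight) auto
  have R: "?R (x(v := y)) = ?R x" for x y
  proof (rule prod.cong[OF refl])
    fix e' assume e': "e' \<in> F - {e}"
    then have "v \<notin> e'" "card e' = 2" using leaf F(2) by auto
    then obtain a b where "e' = {a, b}" "a \<noteq> v" "b \<noteq> v" by (auto simp: card_2_iff)
    then show "edge_weight (x(v := y)) e' = edge_weight x e'" by (simp add: edge_weight_pair)
  qed
  have R_bd: "\<bar>?R x * U y z\<bar> \<le> 1" for x y z
    using prod_edge_weight_bounds[of x] by (auto simp: abs_mult abs_kernel intro!: mult_le_one)
  have "hom_density I F = (\<integral>x. ?R x * U (x w) (x v) \<partial>(\<Pi>\<^sub>M i\<in>I. M))"
    unfolding hom_density_def using F e(1) ew
    by (subst prod.remove[of F e]) (auto simp: edge_weight_pair mult.commute)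
  also have "\<dots> = (\<integral>x. \<integral>y. ?R (x(v := y)) * U ((x(v := y)) w) ((x(v := y)) v) \<partial>M \<partial>(\<Pi>\<^sub>M i\<in>I. M))"
    using R_bd m I by (intro integral_PiM_resample[where B = 1]) auto
  also have "\<dots> = (\<integral>x. ?R x * deg (x w) \<partial>(\<Pi>\<^sub>M i\<in>I. M))"
    unfolding R using ew by (simp add: deg_def)
  also have "\<dots> = (\<integral>x. ?R x * d \<partial>(\<Pi>\<^sub>M i\<in>I. M))"
  proof (rule integral_cong_AE)
    have "AE x in (\<Pi>\<^sub>M i\<in>I. M). deg (x w) = d"
      by (rule AE_PiM_component) (auto intro: prob_space_axioms deg_eq)
    then show "AE x in (\<Pi>\<^sub>M i\<in>I. M). ?R x * deg (x w) = ?R x * d"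
      by eventually_elim simp
  qed (use m in measurable)
  finally show ?thesis by (simp add: hom_density_def)
qed

section \<open>Graphs with three to five edges on five vertices\<close>

lemma vertex_pairs_iff: "e \<in> vertex_pairs k \<longleftrightarrow> e \<subseteq> {1..k} \<and> card e = 2"
  by (simp add: vertex_pairs_def)

definition has_leaf :: "'a set set \<Rightarrow> bool" where
  "has_leaf F \<longleftrightarrow> (\<exists>e\<in>F. \<exists>v\<in>e. \<forall>e'\<in>F. v \<in> e' \<longrightarrow> e' = e)"

definition has_triangle :: "'a set set \<Rightarrow> bool" where
  "has_triangle F \<longleftrightarrow> (\<exists>a b c. distinct [a, b, c] \<and> {{a, b}, {b, c}, {c, a}} \<subseteq> F)"

text \<open>Without leaves a walk can be continued along every edge without turning back. With at
  most five vertices the walk \<open>a, b, c, d, e, f\<close> has to meet an earlier vertex, and its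
  first return closes a cycle of length 3, 4 or 5.\<close>

lemma graph_cycle_cases:
  assumes I: "finite I" "card I \<le> 5" and F: "\<forall>e\<in>F. e \<subseteq> I \<and> card e = 2" "F \<noteq> {}"
    and no_leaf: "\<not> has_leaf F"
  obtains (C3) a b c where "distinct [a, b, c]" "{{a, b}, {b, c}, {c, a}} \<subseteq> F"
  | (C4) a b c d where "distinct [a, b, c, d]" "{{a, b}, {b, c}, {c, d}, {d, a}} \<subseteq> F"
  | (C5) a b c d e where "distinct [a, b, c, d, e]" "{{a, b}, {b, c}, {c, d}, {d, e}, {e, a}} \<subseteq> F"
proof -
  have in_I: "v \<in> I" if "{u, v} \<in> F" for u v
    using bspec[OF F(1) that] by auto
  have nbr: "\<exists>w. w \<noteq> u \<and> w \<noteq> v \<and> {v, w} \<in> F" if uv: "{u, v} \<in> F" for u v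
  proof -
    have "\<not> (\<forall>e'\<in>F. v \<in> e' \<longrightarrow> e' = {u, v})"
    proof
      assume *: "\<forall>e'\<in>F. v \<in> e' \<longrightarrow> e' = {u, v}"
      have "\<exists>x\<in>{u, v}. \<forall>e'\<in>F. x \<in> e' \<longrightarrow> e' = {u, v}"
        by (rule bexI[of "\<lambda>x. \<forall>e'\<in>F. x \<in> e' \<longrightarrow> e' = {u, v}" v, OF *]) simp
      then have "has_leaf F"
        unfolding has_leaf_def by (rule bexI[OF _ uv])
      with no_leaf show False ..
    qed
    then obtain e' where e': "e' \<in> F" "v \<in> e'" "e' \<noteq> {u, v}" by auto
    obtain w where w: "e' = {v, w}" "w \<noteq> v"
      using bspec[OF F(1) e'(1)] e'(2) by (auto simp: card_2_iff)
    have "w \<noteq> u" using e'(3) w(1) by (auto simp: insert_commute)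
    with e'(1) w show ?thesis by auto
  qed
  obtain e0 where e0: "e0 \<in> F" using F(2) by auto
  obtain a b where "e0 = {a, b}" "a \<noteq> b"
    using bspec[OF F(1) e0] by (auto simp: card_2_iff)
  with e0 have ab: "{a, b} \<in> F" "a \<noteq> b" by auto
  obtain c where c: "c \<noteq> a" "c \<noteq> b" "{b, c} \<in> F" using nbr[OF ab(1)] by auto
  obtain d where d: "d \<noteq> b" "d \<noteq> c" "{c, d} \<in> F" using nbr[OF c(3)] by auto
  show thesis
  proof (cases "d = a")
    case True
    show thesis by (rule C3[of a b c]) (use True ab c d in auto)
  next
    case da: False
    obtain e where e: "e \<noteq> c" "e \<noteq> d" "{d, e} \<in> F" using nbr[OF d(3)] by auto
    consider "e = a" | "e = b" | "e \<noteq> a" "e \<noteq> b" by auto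
    then show thesis
    proof cases
      case 1
      show thesis by (rule C4[of a b c d]) (use 1 da ab c d e in auto)
    next
      case 2
      show thesis by (rule C3[of b c d]) (use 2 da ab c d e in auto)
    next
      case 3
      obtain f where f: "f \<noteq> d" "f \<noteq> e" "{e, f} \<in> F" using nbr[OF e(3)] by auto
      consider "f = a" | "f = b" | "f = c" | "f \<noteq> a" "f \<noteq> b" "f \<noteq> c" by auto
      then show thesis
      proof cases
        case 1
        show thesis by (rule C5[of a b c d e]) (use 1 3 da ab c d e f in auto)
      next
        case 2
        show thesis by (rule C4[of b c d e]) (use 2 3 da ab c d e f in auto)
      next
        case c3: 3
        show thesis by (rule C3[of c d e]) (use c3 3 da ab c d e f in auto)
      next
        case 4
        have "a \<in> I" using in_I[of b a] ab(1) by (simp add: insert_commute)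
        then have "{a, b, c, d, e, f} \<subseteq> I"
          using in_I[OF ab(1)] in_I[OF c(3)] in_I[OF d(3)] in_I[OF e(3)] in_I[OF f(3)] by simp
        then have "card {a, b, c, d, e, f} \<le> 5"
          using I by (meson card_mono order_trans)
        moreover have "card {a, b, c, d, e, f} = 6"
          using 4 3 da ab c d e f by simp
        ultimately show thesis by simp
      qed
    qed
  qed
qed

lemma card_C4: "distinct [a, b, c, d] \<Longrightarrow> card {{a, b}, {b, c}, {c, d}, {d, a}} = 4"
  and card_C5: "distinct [a, b, c, d, e] \<Longrightarrow> card {{a, b}, {b, c}, {c, d}, {d, e}, {e, a}} = 5"
  and card_C3: "distinct [a, b, c] \<Longrightarrow> card {{a, b}, {b, c}, {c, a}} = 3"
  by (auto simp: card_insert_if doubleton_eq_iff)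

text \<open>The fifth edge is a chord, which closes a triangle, or it has an endpoint off the cycle,
  which is then a leaf.\<close>

lemma C4_plus_edge:
  assumes dist: "distinct [a, b, c, d]" and C4: "{{a, b}, {b, c}, {c, d}, {d, a}} \<subseteq> F"
    and F: "card F = 5" "\<And>e. e \<in> F \<Longrightarrow> card e = 2"
  shows "has_leaf F \<or> has_triangle F"
proof -
  let ?C = "{{a, b}, {b, c}, {c, d}, {d, a}}"
  have "card (F - ?C) = 1"
    using card_Diff_subset[OF _ C4] F(1) card_C4[OF dist] by simp
  then obtain f where "F - ?C = {f}" by (auto simp: card_1_singleton_iff)
  with C4 have Ff: "F = insert f ?C" "f \<notin> ?C" by blast+
  have "f \<in> F" using Ff(1) by blast
  then obtain u v where uv: "f = {u, v}" "u \<noteq> v"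
    using F(2)[of f] by (auto simp: card_2_iff)
  show ?thesis
  proof (cases "f \<subseteq> {a, b, c, d}")
    case True
    then have "f = {a, c} \<or> f = {b, d}"
      using uv Ff(2) unfolding uv(1) by (auto simp: doubleton_eq_iff)
    then show ?thesis
    proof
      assume "f = {a, c}"
      then have "{c, a} \<in> F" using \<open>f \<in> F\<close> by (simp add: insert_commute)
      then have "{{a, b}, {b, c}, {c, a}} \<subseteq> F" using C4 by simp
      moreover have "distinct [a, b, c]" using dist by simp
      ultimately show ?thesis unfolding has_triangle_def by blast
    next
      assume "f = {b, d}"
      then have "{d, b} \<in> F" using \<open>f \<in> F\<close> by (simp add: insert_commute)
      then have "{{b, c}, {c, d}, {d, b}} \<subseteq> F" using C4 by simp
      moreover have "distinct [b, c, d]" using dist by simp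
      ultimately show ?thesis unfolding has_triangle_def by blast
    qed
  next
    case False
    then obtain w where w: "w \<in> f" "w \<notin> {a, b, c, d}" by auto
    then have "\<forall>e'\<in>F. w \<in> e' \<longrightarrow> e' = f" unfolding Ff(1) by auto
    then show ?thesis using w(1) \<open>f \<in> F\<close> unfolding has_leaf_def by blast
  qed
qed

text \<open>Graphs with a leaf reduce to fewer edges and graphs with a triangle have density 0 once
  \<open>t_C3\<close> does. The point is that the 4-cycle and the 5-cycle are the only
  others.\<close>

lemma small_graph_cases:
  assumes I: "finite I" "card I \<le> 5" and F: "\<forall>e\<in>F. e \<subseteq> I \<and> card e = 2"
    and card: "3 \<le> card F" "card F \<le> 5"
  obtains (leaf) "has_leaf F" | (triangle) "has_triangle F"
  | (C4) a b c d where "card F = 4" "distinct [a, b, c, d]" "F = {{a, b}, {b, c}, {c, d}, {d, a}}"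
  | (C5) a b c d e where "card F = 5" "distinct [a, b, c, d, e]" "F = {{a, b}, {b, c}, {c, d}, {d, e}, {e, a}}"
proof (cases "has_leaf F")
  case False
  have fin: "finite F" using card by (intro card_ge_0_finite) simp
  have ne: "F \<noteq> {}" using card by auto
  show thesis
  proof (rule graph_cycle_cases[OF I F ne False], goal_cases C3 C4 C5)
    case (C3 a b c)
    then show thesis using triangle unfolding has_triangle_def by blast
  next
    case (C4 a b c d)
    have "4 \<le> card F" using card_mono[OF fin C4(2)] card_C4[OF C4(1)] by simp
    then consider "card F = 4" | "card F = 5" using card by linarith
    then show thesis
    proof cases
      case 1
      have "{{a, b}, {b, c}, {c, d}, {d, a}} = F"
        by (rule card_subset_eq[OF fin C4(2)]) (simp only: 1 card_C4[OF C4(1)])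
      then show thesis by (rule that(3)[OF 1 C4(1) sym])
    next
      case 2
      have "has_leaf F \<or> has_triangle F"
        using F by (intro C4_plus_edge[OF C4 2]) simp
      then show thesis using that(1,2) by blast
    qed
  next
    case (C5 a b c d e)
    have 5: "card F = 5"
      using card_mono[OF fin C5(2)] card(2) unfolding card_C5[OF C5(1)] by (rule antisym[rotated])
    have "{{a, b}, {b, c}, {c, d}, {d, e}, {e, a}} = F"
      by (rule card_subset_eq[OF fin C5(2)]) (simp only: 5 card_C5[OF C5(1)])
    then show thesis by (rule that(4)[OF 5 C5(1) sym])
  qed
qed (rule leaf)

text \<open>Lets one compare the sums of homomorphism densities over all graphs with \<open>m\<close> edges without
  counting the copies of the one graph whose density is not yet known.\<close>

lemma sum_eq_imp_eq_of_dichotomy: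
  fixes f g :: "'a \<Rightarrow> real"
  assumes S: "finite S" and sum: "sum f S = sum g S"
    and cases: "\<And>F. F \<in> S \<Longrightarrow> f F = g F \<or> f F = \<alpha> \<and> g F = \<beta>"
    and F0: "F0 \<in> S" "f F0 = \<alpha>" "g F0 = \<beta>"
  shows "\<alpha> = \<beta>"
proof (rule ccontr)
  assume ne: "\<alpha> \<noteq> \<beta>"
  let ?T = "{F \<in> S. f F \<noteq> g F}"
  have "0 = (\<Sum>F\<in>S. f F - g F)" using sum by (simp add: sum_subtractf)
  also have "\<dots> = (\<Sum>F\<in>?T. f F - g F)" by (rule sum.mono_neutral_right) (use S in auto)
  also have "\<dots> = (\<Sum>F\<in>?T. \<alpha> - \<beta>)" by (rule sum.cong) (use cases in auto)
  \<comment> \<open>The last sum is \<open>card ?T\<close> times the nonzero number \<alpha> -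
    \<beta>.\<close>
  finally have "?T = {}" using ne S by simp
  then show False using F0 ne by auto
qed

section \<open>From moment sums to cycle densities\<close>

lemma (in regular_kernel) t_path_eq: "t_path = d\<^sup>2"
proof -
  have "t_path = (\<integral>x. d\<^sup>2 \<partial>M)"
    unfolding t_path_def using deg_eq by (intro integral_cong_AE) auto
  then show ?thesis by (simp add: prob_space)
qed

text \<open>The number of edges is raised from 1 to 5. At each stage all densities are already known
  to agree, except those of the copies of one graph: edge, two-edge path, triangle, 4-cycle,
  5-cycle. The moment equation then settles that one. Regularity of \<open>U\<close>, on which leaf
  removal rests, comes out of the first two stages.\<close>

lemma hom_moments_determine:
  assumes "edge_kernel M U" and "regular_kernel N V d"
    and moments: "\<And>m. (\<Sum>F | F \<subseteq> vertex_pairs 5 \<and> card F = m. edge_kernel.hom_density M U {1..5} F)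
      = (\<Sum>F | F \<subseteq> vertex_pairs 5 \<and> card F = m. edge_kernel.hom_density N V {1..5} F)"
    and V3: "edge_kernel.t_C3 N V = 0"
  shows "regular_kernel M U d" "edge_kernel.t_C3 M U = 0"
    "edge_kernel.t_C4 M U = edge_kernel.t_C4 N V" "edge_kernel.t_C5 M U = edge_kernel.t_C5 N V"
proof -
  interpret U: edge_kernel M U by fact
  interpret V: regular_kernel N V d by fact
  define I where "I = {1..5::nat}"
  have I [simp]: "finite I" "card I \<le> 5" "1 \<in> I" "2 \<in> I" "3 \<in> I" "4 \<in> I" "5 \<in> I" "Suc 0 \<in> I"
    by (auto simp: I_def)
  let ?S = "\<lambda>m. {F. F \<subseteq> vertex_pairs 5 \<and> card F = m}"
  let ?u = "U.hom_density I" and ?v = "V.hom_density I"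
  have F: "e \<subseteq> I \<and> card e = 2" if "F \<subseteq> vertex_pairs 5" "e \<in> F" for F e
    using that vertex_pairs_iff[of e 5] by (auto simp: I_def)
  have F': "\<forall>e\<in>F. e \<subseteq> I \<and> card e = 2" if "F \<subseteq> vertex_pairs 5" for F
    using F[OF that] by auto
  have finF: "finite F" if "F \<subseteq> vertex_pairs 5" for F
    using that finite_vertex_pairs by (rule finite_subset)
  have vp: "{a, b} \<in> vertex_pairs 5" if "a \<in> I" "b \<in> I" "a \<noteq> b" for a b
    using that by (auto simp: vertex_pairs_iff I_def)
  have vert: "a \<in> I" "b \<in> I" if "F \<subseteq> vertex_pairs 5" "{a, b} \<in> F" for F a b
    using F[OF that] by auto
  \<comment> \<open>\<open>F0\<close> certifies that the exceptional graph occurs. The second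
    conclusion, for all graphs with \<open>m\<close> edges, feeds the leaf step for
    \<open>m + 1\<close> edges.\<close>
  have compare: "\<alpha> = \<beta>" "\<And>F. F \<in> ?S m \<Longrightarrow> ?u F = ?v F"
    if cases: "\<And>F. F \<in> ?S m \<Longrightarrow> ?u F = ?v F \<or> ?u F = \<alpha> \<and> ?v F = \<beta>"
      and F0: "F0 \<in> ?S m" "?u F0 = \<alpha>" "?v F0 = \<beta>" for m \<alpha> \<beta> F0
  proof -
    have "finite (?S m)"
      by (rule finite_subset[of _ "Pow (vertex_pairs 5)"]) auto
    then show *: "\<alpha> = \<beta>"
      using moments[of m, folded I_def] cases F0 by (rule sum_eq_imp_eq_of_dichotomy)
    show "?u F = ?v F" if "F \<in> ?S m" for F
      using cases[OF that] * by auto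
  qed
  have case1: "?u F = ?v F \<or> ?u F = U.t_edge \<and> ?v F = V.t_edge" if F1: "F \<in> ?S 1" for F
  proof -
    obtain e where e: "F = {e}" using F1 by (auto simp: card_1_singleton_iff)
    then obtain a b where ab: "e = {a, b}" "a \<noteq> b" using F[of F e] F1 by (auto simp: card_2_iff)
    then show ?thesis
      using vert[of F a b] F1 e by (simp add: U.hom_density_edge V.hom_density_edge)
  qed
  have F0_1: "{{1, 2}} \<in> ?S 1" using vp[of 1 2] by simp
  have p1: "?u {{1, 2}} = U.t_edge" "?v {{1, 2}} = V.t_edge"
    by (rule U.hom_density_edge V.hom_density_edge; simp)+
  note t1 = compare(1)[OF case1 F0_1 p1]
  have case2: "?u F = ?v F \<or> ?u F = U.t_path \<and> ?v F = V.t_path" if F2: "F \<in> ?S 2" for F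
  proof -
    obtain e f where ef: "F = {e, f}" "e \<noteq> f" using F2 by (auto simp: card_2_iff)
    have e: "e \<subseteq> I" "card e = 2" and f: "f \<subseteq> I" "card f = 2"
      using F[of F e] F[of F f] F2 ef by auto
    show ?thesis
    proof (cases "e \<inter> f = {}")
      case True
      obtain a b where ab: "e = {a, b}" "a \<noteq> b" using e(2) by (auto simp: card_2_iff)
      obtain c d where cd: "f = {c, d}" "c \<noteq> d" using f(2) by (auto simp: card_2_iff)
      have "distinct [a, b, c, d]" "a \<in> I" "b \<in> I" "c \<in> I" "d \<in> I"
        using True ab cd e f by auto
      then show ?thesis
        unfolding ef ab cd by (simp only: U.hom_density_two_edges V.hom_density_two_edges I t1 simp_thms)
    next
      case False
      then obtain b where b: "b \<in> e" "b \<in> f" by auto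
      obtain a where a: "e = {a, b}" "a \<noteq> b" using e(2) b by (auto simp: card_2_iff)
      obtain c where c: "f = {b, c}" "c \<noteq> b" using f(2) b by (auto simp: card_2_iff)
      have "distinct [a, b, c]" "a \<in> I" "b \<in> I" "c \<in> I"
        using a c e f ef by auto
      then show ?thesis
        unfolding ef a c by (simp only: U.hom_density_path V.hom_density_path I simp_thms)
    qed
  qed
  have F0_2: "{{1, 2}, {2, 3}} \<in> ?S 2" using vp[of 1 2] vp[of 2 3] by (simp add: doubleton_eq_iff)
  have p2: "?u {{1, 2}, {2, 3}} = U.t_path" "?v {{1, 2}, {2, 3}} = V.t_path"
    by (rule U.hom_density_path V.hom_density_path; simp)+
  note t2 = compare(1)[OF case2 F0_2 p2] and eq2 = compare(2)[OF case2 F0_2 p2]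
  \<comment> \<open>The relation \<open>t_path = t_edge^2\<close> holds for the regular kernel
    \<open>V\<close> and carries over to \<open>U\<close>, whose degrees therefore have variance
    0.\<close>
  have "AE x in M. U.deg x = d"
    using U.AE_deg_const t1 t2 V.t_path_eq V.t_edge_eq by simp
  then interpret U': regular_kernel M U d by unfold_locales
  show "regular_kernel M U d" by unfold_locales
  \<comment> \<open>Removing the leaf edge extracts the same factor \<open>d\<close> on both sides
    and leaves a graph with \<open>m\<close> edges on the same vertex set.\<close>
  have leaf_step: "?u F = ?v F"
    if "F \<in> ?S (Suc m)" "has_leaf F" and IH: "\<And>F. F \<in> ?S m \<Longrightarrow> ?u F = ?v F" for F m
  proof -
    obtain e v where e: "e \<in> F" "v \<in> e" "\<And>e'. e' \<in> F \<Longrightarrow> v \<in> e' \<Longrightarrow> e' = e"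
      using \<open>has_leaf F\<close> unfolding has_leaf_def by blast
    have FS: "F \<subseteq> vertex_pairs 5" using that(1) by auto
    have "F - {e} \<in> ?S m" using that(1) e(1) finF by auto
    then show ?thesis
      using U'.hom_density_leaf[OF I(1) finF[OF FS] F[OF FS] e] V.hom_density_leaf[OF I(1) finF[OF FS] F[OF FS] e] IH
      by simp
  qed
  have case3: "?u F = ?v F \<or> ?u F = U.t_C3 \<and> ?v F = V.t_C3" if F3: "F \<in> ?S 3" for F
  proof -
    have FS: "F \<subseteq> vertex_pairs 5" and c: "3 \<le> card F" "card F \<le> 5" using F3 by auto
    show ?thesis
    proof (rule small_graph_cases[OF I(1,2) F'[OF FS] c], goal_cases leaf triangle C4 C5)
      case leaf
      then show ?thesis using leaf_step[of F 2] eq2 F3 by auto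
    next
      case triangle
      then obtain a b c where abc: "distinct [a, b, c]" "{{a, b}, {b, c}, {c, a}} \<subseteq> F"
        by (auto simp: has_triangle_def)
      then have Feq: "F = {{a, b}, {b, c}, {c, a}}"
        using card_subset_eq[OF finF[OF FS] abc(2)] card_C3[OF abc(1)] F3 by auto
      have "a \<in> I" "b \<in> I" "c \<in> I"
        using vert[of F a b] vert[of F b c] abc FS by auto
      with abc(1) show ?thesis
        unfolding Feq by (simp only: U.hom_density_C3 V.hom_density_C3 I simp_thms)
    qed (use F3 in auto)
  qed
  have F0_3: "{{1, 2}, {2, 3}, {3, 1}} \<in> ?S 3"
    using vp[of 1 2] vp[of 2 3] vp[of 3 1] card_C3[of 1 2 "3::nat"] by simp
  have p3: "?u {{1, 2}, {2, 3}, {3, 1}} = U.t_C3" "?v {{1, 2}, {2, 3}, {3, 1}} = V.t_C3"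
    by (rule U.hom_density_C3 V.hom_density_C3; simp)+
  note t3 = compare(1)[OF case3 F0_3 p3] and eq3 = compare(2)[OF case3 F0_3 p3]
  show U3: "U.t_C3 = 0" using t3 V3 by simp
  have triangle_zero: "?u F = 0 \<and> ?v F = 0" if FS: "F \<subseteq> vertex_pairs 5" and "has_triangle F" for F
  proof -
    obtain a b c where abc: "distinct [a, b, c]" "{{a, b}, {b, c}, {c, a}} \<subseteq> F"
      using \<open>has_triangle F\<close> by (auto simp: has_triangle_def)
    have "a \<in> I" "b \<in> I" "c \<in> I"
      using vert[of F a b] vert[of F b c] abc FS by auto
    then have "?u {{a, b}, {b, c}, {c, a}} = 0" "?v {{a, b}, {b, c}, {c, a}} = 0"
      using abc(1) by (simp_all only: U.hom_density_C3 V.hom_density_C3 I U3 V3)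
    then show ?thesis
      using U.hom_density_antimono[OF finF[OF FS] abc(2) F[OF FS]] U.hom_density_nonneg[of I F]
        V.hom_density_antimono[OF finF[OF FS] abc(2) F[OF FS]] V.hom_density_nonneg[of I F] by simp
  qed
  have case4: "?u F = ?v F \<or> ?u F = U.t_C4 \<and> ?v F = V.t_C4" if F4: "F \<in> ?S 4" for F
  proof -
    have FS: "F \<subseteq> vertex_pairs 5" and c: "3 \<le> card F" "card F \<le> 5" using F4 by auto
    show ?thesis
    proof (rule small_graph_cases[OF I(1,2) F'[OF FS] c], goal_cases leaf triangle C4 C5)
      case leaf
      then show ?thesis using leaf_step[of F 3] eq3 F4 by auto
    next
      case triangle
      then show ?thesis using triangle_zero[OF FS] by simp
    next
      case (C4 a b c d)
      have "a \<in> I" "b \<in> I" "c \<in> I" "d \<in> I"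
        using vert[of F a b] vert[of F c d] C4(3) FS by auto
      with C4(2) show ?thesis
        unfolding C4(3) by (simp only: U.hom_density_C4 V.hom_density_C4 I simp_thms)
    qed (use F4 in auto)
  qed
  have F0_4: "{{1, 2}, {2, 3}, {3, 4}, {4, 1}} \<in> ?S 4"
    using vp[of 1 2] vp[of 2 3] vp[of 3 4] vp[of 4 1] card_C4[of 1 2 3 "4::nat"] by simp
  have p4: "?u {{1, 2}, {2, 3}, {3, 4}, {4, 1}} = U.t_C4" "?v {{1, 2}, {2, 3}, {3, 4}, {4, 1}} = V.t_C4"
    by (rule U.hom_density_C4 V.hom_density_C4; simp)+
  note eq4 = compare(2)[OF case4 F0_4 p4]
  show "U.t_C4 = V.t_C4" by (rule compare(1)[OF case4 F0_4 p4])
  have case5: "?u F = ?v F \<or> ?u F = U.t_C5 \<and> ?v F = V.t_C5" if F5: "F \<in> ?S 5" for F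
  proof -
    have FS: "F \<subseteq> vertex_pairs 5" and c: "3 \<le> card F" "card F \<le> 5" using F5 by auto
    show ?thesis
    proof (rule small_graph_cases[OF I(1,2) F'[OF FS] c], goal_cases leaf triangle C4 C5)
      case leaf
      then show ?thesis using leaf_step[of F 4] eq4 F5 by auto
    next
      case triangle
      then show ?thesis using triangle_zero[OF FS] by simp
    next
      case (C5 a b c d e)
      have "a \<in> I" "b \<in> I" "c \<in> I" "d \<in> I" "e \<in> I"
        using vert[of F a b] vert[of F c d] vert[of F d e] C5(3) FS by auto
      with C5(2) show ?thesis
        unfolding C5(3) by (simp only: U.hom_density_C5 V.hom_density_C5 I simp_thms)
    qed (use F5 in auto)
  qed
  have F0_5: "{{1, 2}, {2, 3}, {3, 4}, {4, 5}, {5, 1}} \<in> ?S 5"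
    using vp[of 1 2] vp[of 2 3] vp[of 3 4] vp[of 4 5] vp[of 5 1] card_C5[of 1 2 3 4 "5::nat"] by simp
  have p5: "?u {{1, 2}, {2, 3}, {3, 4}, {4, 5}, {5, 1}} = U.t_C5"
    "?v {{1, 2}, {2, 3}, {3, 4}, {4, 5}, {5, 1}} = V.t_C5"
    by (rule U.hom_density_C5 V.hom_density_C5; simp)+
  show "U.t_C5 = V.t_C5" by (rule compare(1)[OF case5 F0_5 p5])
qed

section \<open>Sampling from graphons\<close>

abbreviation unit_measure :: "real measure" where
  "unit_measure \<equiv> restrict_space lborel {0..1}"

lemma measurable_unit_square_id:
  "(\<lambda>z. z) \<in> unit_measure \<Otimes>\<^sub>M unit_measure \<rightarrow>\<^sub>M borel \<Otimes>\<^sub>M borel"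
proof -
  have id: "(\<lambda>x. x) \<in> unit_measure \<rightarrow>\<^sub>M borel"
    by (rule measurable_restrict_space1) simp
  have "(\<lambda>z. (fst z, snd z)) \<in> unit_measure \<Otimes>\<^sub>M unit_measure \<rightarrow>\<^sub>M borel \<Otimes>\<^sub>M borel"
    by (intro measurable_Pair measurable_compose[OF measurable_fst id]
        measurable_compose[OF measurable_snd id])
  then show ?thesis by simp
qed

lemma space_unit_square: "space (unit_measure \<Otimes>\<^sub>M unit_measure) = {0..1} \<times> {0..1}"
  by (simp add: space_pair_measure space_restrict_space)

text \<open>A Lebesgue measurable function agrees almost everywhere with a Borel measurable one.
  Clamping the latter to the unit interval and reflecting its values from \<open>x \<le> y\<close>
  across the diagonal restores bounds and symmetry at every point.\<close>

lemma graphon_ex_edge_kernel: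
  assumes U: "graphon U"
  obtains V where "edge_kernel unit_measure V"
    "AE z in unit_measure \<Otimes>\<^sub>M unit_measure. U (fst z) (snd z) = V (fst z) (snd z)"
proof -
  interpret M: prob_space unit_measure by (rule prob_space_unit_interval)
  interpret P: pair_prob_space unit_measure unit_measure ..
  let ?g = "\<lambda>z. if z \<in> {0..1} \<times> {0..1} then (\<lambda>(x, y). U x y) z else 0"
  have "?g \<in> borel_measurable lebesgue"
  proof (rule borel_measurable_if_I)
    show "{0..1::real} \<times> {0..1::real} \<in> sets lebesgue"
      by (intro sets_completionI_sets) (simp add: borel_closed closed_Times)
  qed (use U in \<open>simp add: graphon_def\<close>)
  then obtain g where g: "g \<in> borel_measurable lborel" and ae: "AE z in lborel. ?g z = g z"
    by (blast dest: completion_ex_borel_measurable_real)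
  obtain N where N: "N \<in> null_sets lborel" "{z \<in> space lborel. ?g z \<noteq> g z} \<subseteq> N"
    using ae unfolding eventually_ae_filter by auto
  have g' [measurable]: "g \<in> borel_measurable (unit_measure \<Otimes>\<^sub>M unit_measure)"
    using measurable_compose[OF measurable_unit_square_id, of g borel] g by (simp add: borel_prod)
  have "N \<in> sets (borel \<Otimes>\<^sub>M borel)"
    using N(1) unfolding borel_prod by (auto simp: null_sets_def)
  then have "N \<in> null_sets (distr (unit_measure \<Otimes>\<^sub>M unit_measure) (borel \<Otimes>\<^sub>M borel) (\<lambda>z. z))"
    using null_sets_square[OF N(1)] by (simp add: null_sets_def)
  then have "AE z in distr (unit_measure \<Otimes>\<^sub>M unit_measure) (borel \<Otimes>\<^sub>M borel) (\<lambda>z. z). z \<notin> N"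
    by (rule AE_not_in)
  then have N1: "AE z in unit_measure \<Otimes>\<^sub>M unit_measure. z \<notin> N"
    by (rule AE_distrD[OF measurable_unit_square_id])
  \<comment> \<open>Below the diagonal \<open>V\<close> reads \<open>g\<close> at the mirrored
    point, which must avoid \<open>N\<close> as well.\<close>
  then have N2: "AE z in unit_measure \<Otimes>\<^sub>M unit_measure. (snd z, fst z) \<notin> N"
    by (subst (asm) P.distr_pair_swap) (auto dest!: AE_distrD[rotated] simp: split_beta)
  define h where "h = (\<lambda>x y. max 0 (min 1 (g (x, y))))"
  define V where "V = (\<lambda>x y. if x \<le> y then h x y else h y x)"
  have le: "{z \<in> space (unit_measure \<Otimes>\<^sub>M unit_measure). fst z \<le> snd z} \<in> sets (unit_measure \<Otimes>\<^sub>M unit_measure)"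
    by (intro borel_measurable_le measurable_compose[OF measurable_unit_square_id measurable_fst]
        measurable_compose[OF measurable_unit_square_id measurable_snd])
  have "edge_kernel unit_measure V"
  proof unfold_locales
    have "(\<lambda>z. if fst z \<le> snd z then h (fst z) (snd z) else h (snd z) (fst z))
        \<in> borel_measurable (unit_measure \<Otimes>\<^sub>M unit_measure)"
      unfolding h_def by (intro measurable_If le) measurable
    then show "(\<lambda>(x, y). V x y) \<in> borel_measurable (unit_measure \<Otimes>\<^sub>M unit_measure)"
      by (simp add: V_def split_beta)
    show "V x y = V y x" "0 \<le> V x y" "V x y \<le> 1" for x y
      by (auto simp: V_def h_def)
  qed
  have eq: "?g w = g w" if "w \<notin> N" for w
  proof (rule ccontr)
    assume "?g w \<noteq> g w"
    then have "w \<in> {z \<in> space lborel. ?g z \<noteq> g z}"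
      by (simp only: mem_Collect_eq space_lborel space_borel UNIV_I simp_thms not_False_eq_True)
    with N(2) that show False by blast
  qed
  have "AE z in unit_measure \<Otimes>\<^sub>M unit_measure. U (fst z) (snd z) = V (fst z) (snd z)"
    using N1 N2 AE_space
  proof eventually_elim
    case (elim z)
    obtain x y where z: "z = (x, y)" by (cases z)
    have xy: "x \<in> {0..1}" "y \<in> {0..1}"
      using elim(3) unfolding z space_unit_square by auto
    have Ug: "U x y = g (x, y)" "U y x = g (y, x)"
      using eq[of "(x, y)"] eq[of "(y, x)"] elim(1,2) xy by (simp_all add: z)
    have "U x y = U y x" "0 \<le> U x y" "U x y \<le> 1"
      using U xy by (auto simp: graphon_def)
    then show ?case
      by (simp add: z V_def h_def flip: Ug)
  qed
  with \<open>edge_kernel unit_measure V\<close> show thesis by (rule that)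
qed

text \<open>Clamping the coordinates extends \<open>V\<close> from the unit square to a Borel
  function on the plane that agrees with \<open>V\<close> on the square.\<close>

lemma edge_kernel_imp_graphon:
  assumes "edge_kernel unit_measure V"
  shows "graphon V"
proof -
  interpret edge_kernel unit_measure V by fact
  let ?c = "\<lambda>x::real. max 0 (min 1 x)"
  have c: "?c \<in> borel \<rightarrow>\<^sub>M unit_measure"
    by (rule measurable_restrict_space2) auto
  have "(\<lambda>z. V (?c (fst z)) (?c (snd z))) \<in> borel_measurable (borel \<Otimes>\<^sub>M borel)"
    by (intro measurable_kernel measurable_compose[OF _ c] measurable_fst measurable_snd)
  then have "(\<lambda>z. V (?c (fst z)) (?c (snd z))) \<in> borel_measurable lebesgue"
    by (intro measurable_completion) (simp add: borel_prod)
  then have "(\<lambda>z. V (?c (fst z)) (?c (snd z))) \<in> borel_measurable (lebesgue_on ({0..1} \<times> {0..1}))"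
    by (rule measurable_restrict_space1)
  also have "?this \<longleftrightarrow> (\<lambda>(x, y). V x y) \<in> borel_measurable (lebesgue_on ({0..1} \<times> {0..1}))"
    by (intro measurable_cong) (auto simp: space_restrict_space)
  finally show ?thesis
    by (simp add: graphon_def kernel_sym[symmetric] kernel_nonneg kernel_le_1)
qed

lemma sets_graph_sample [measurable_cong]: "sets (graph_sample k W) = sets (count_space UNIV)"
proof -
  interpret T: prob_space "vertex_types k" by (rule prob_space_vertex_types)
  show ?thesis
    unfolding graph_sample_def using T.not_empty by (intro sets_bind) simp_all
qed

text \<open>The sample depends on the kernel only through its values at the finitely many pairs of
  types of distinct vertices, and each such pair almost surely avoids the exceptional null
  set.\<close>

lemma graph_sample_cong:
  assumes U: "graphon U" and V: "graphon V"
    and ae: "AE z in unit_measure \<Otimes>\<^sub>M unit_measure. U (fst z) (snd z) = V (fst z) (snd z)"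
  shows "graph_sample k U = graph_sample k V"
proof (rule measure_eqI)
  interpret M: prob_space unit_measure by (rule prob_space_unit_interval)
  interpret T: prob_space "vertex_types k" by (rule prob_space_vertex_types)
  show "sets (graph_sample k U) = sets (graph_sample k V)"
    by (simp add: sets_graph_sample)
  fix A
  have "AE x in \<Pi>\<^sub>M i\<in>{1..k}. unit_measure. \<forall>e\<in>vertex_pairs k. U (x (Min e)) (x (Max e)) = V (x (Min e)) (x (Max e))"
  proof (rule AE_finite_allI)
    fix e assume e: "e \<in> vertex_pairs k"
    show "AE x in \<Pi>\<^sub>M i\<in>{1..k}. unit_measure. U (x (Min e)) (x (Max e)) = V (x (Min e)) (x (Max e))"
      using vertex_pairs_MinMax[OF e] by (intro M.AE_PiM_pair ae) auto
  qed simp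
  then have "AE x in vertex_types k. \<forall>e\<in>vertex_pairs k. U (x (Min e)) (x (Max e)) = V (x (Min e)) (x (Max e))"
    unfolding vertex_types_def by (rule AE_completion)
  then have "AE x in vertex_types k. edges_given_types k U x = edges_given_types k V x"
  proof eventually_elim
    case (elim x)
    then show ?case
      unfolding edges_given_types_def by (intro arg_cong[where f = "map_pmf _"] Pi_pmf_cong) auto
  qed
  then show "emeasure (graph_sample k U) A = emeasure (graph_sample k V) A"
    unfolding emeasure_graph_sample[OF U] emeasure_graph_sample[OF V]
    by (intro nn_integral_cong_AE) (auto elim!: eventually_mono)
qed

text \<open>Given the types, edges are independent, so all edges of \<open>F\<close> are present
  with conditional probability the product of their weights; averaging over the types yields the
  homomorphism density.\<close>

lemma measure_graph_sample_superset:
  assumes "edge_kernel unit_measure V" "graphon V" and F: "F \<subseteq> vertex_pairs k"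
  shows "measure (graph_sample k V) {G. F \<subseteq> G} = edge_kernel.hom_density unit_measure V {1..k} F"
proof -
  interpret edge_kernel unit_measure V by fact
  interpret P: prob_space "\<Pi>\<^sub>M i\<in>{1..k}. unit_measure" by (rule prob_space_PiM_const)
  have F': "\<And>e. e \<in> F \<Longrightarrow> e \<subseteq> {1..k} \<and> card e = 2"
    using F by (auto simp: vertex_pairs_def)
  have edges: "emeasure (measure_pmf (edges_given_types k V x)) {G. F \<subseteq> G} = ennreal (\<Prod>e\<in>F. edge_weight x e)" for x
  proof -
    \<comment> \<open>The event is written as a product: coordinates in \<open>F\<close> are forced
      to \<open>True\<close>, the others are free.\<close>
    let ?B = "\<lambda>e. if e \<in> F then {True} else UNIV"
    let ?p = "Pi_pmf (vertex_pairs k) False (\<lambda>e. bernoulli_pmf (V (x (Min e)) (x (Max e))))"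
    have "measure (measure_pmf (edges_given_types k V x)) {G. F \<subseteq> G} = measure (measure_pmf ?p) (Pi (vertex_pairs k) ?B)"
      unfolding edges_given_types_def measure_map_pmf
      using F by (intro arg_cong[where f = "measure _"]) (auto simp: Pi_iff split: if_splits)
    also have "\<dots> = (\<Prod>e\<in>vertex_pairs k. if e \<in> F then edge_weight x e else 1)"
      by (subst measure_Pi_pmf_Pi)
        (auto intro!: prod.cong simp: edge_weight_def measure_pmf_single kernel_nonneg kernel_le_1)
    also have "\<dots> = (\<Prod>e\<in>F. edge_weight x e)"
      using F by (subst prod.inter_restrict[symmetric]) (auto simp: Int_absorb1)
    finally show ?thesis by (simp add: measure_pmf.emeasure_eq_measure)
  qed
  have "emeasure (graph_sample k V) {G. F \<subseteq> G} = (\<integral>\<^sup>+x. ennreal (\<Prod>e\<in>F. edge_weight x e) \<partial>(\<Pi>\<^sub>M i\<in>{1..k}. unit_measure))"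
    unfolding emeasure_graph_sample[OF \<open>graphon V\<close>] edges vertex_types_def nn_integral_completion ..
  also have "\<dots> = ennreal (hom_density {1..k} F)"
    unfolding hom_density_def
    by (intro nn_integral_eq_integral P.integrable_bounded[where B = 1] measurable_prod_edge_weight F')
      (auto simp: prod_edge_weight_bounds)
  finally show ?thesis
    by (simp add: measure_def hom_density_nonneg)
qed

lemma AE_graph_sample_subset:
  assumes "graphon V"
  shows "AE G in graph_sample k V. G \<subseteq> vertex_pairs k"
proof -
  have "emeasure (measure_pmf (edges_given_types k V x)) {G. \<not> G \<subseteq> vertex_pairs k} = 0" for x
    using set_pmf_edges_given_types[of k V x] by (auto simp: measure_pmf.emeasure_eq_measure measure_pmf_zero_iff)
  then have "emeasure (graph_sample k V) {G. \<not> G \<subseteq> vertex_pairs k} = 0"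
    unfolding emeasure_graph_sample[OF assms] by simp
  then show ?thesis
    by (intro AE_I[where N = "{G. \<not> G \<subseteq> vertex_pairs k}"]) (auto simp: sets_graph_sample)
qed

text \<open>For a sampled graph \<open>G\<close>, \<open>card G choose m\<close> counts the
  \<open>m\<close>-element sets of edges of \<open>G\<close>; linearity of expectation turns its
  mean into a sum of inclusion probabilities.\<close>

lemma edge_count_factorial_moment:
  assumes V: "edge_kernel unit_measure V" "graphon V"
  shows "(\<integral>n. real (n choose m) \<partial>edge_count_distr k V)
    = (\<Sum>F | F \<subseteq> vertex_pairs k \<and> card F = m. edge_kernel.hom_density unit_measure V {1..k} F)"
proof -
  interpret S: prob_space "graph_sample k V" by (rule prob_space_graph_sample[OF V(2)])
  let ?S = "{F. F \<subseteq> vertex_pairs k \<and> card F = m}"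
  have fin: "finite ?S"
    by (rule finite_subset[of _ "Pow (vertex_pairs k)"]) auto
  have "(\<integral>n. real (n choose m) \<partial>edge_count_distr k V) = (\<integral>G. real (card G choose m) \<partial>graph_sample k V)"
    unfolding edge_count_distr_def by (rule integral_distr) auto
  also have "\<dots> = (\<integral>G. (\<Sum>F\<in>?S. indicator {G. F \<subseteq> G} G) \<partial>graph_sample k V)"
  proof (rule integral_cong_AE)
    show "AE G in graph_sample k V. real (card G choose m) = (\<Sum>F\<in>?S. indicator {G. F \<subseteq> G} G)"
      using AE_graph_sample_subset[OF V(2)]
    proof eventually_elim
      case (elim G)
      have "finite G" using elim finite_vertex_pairs by (rule finite_subset)
      then have "real (card G choose m) = real (card {F. F \<subseteq> G \<and> card F = m})"
        by (simp add: n_subsets)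
      also have "{F. F \<subseteq> G \<and> card F = m} = {F \<in> ?S. F \<subseteq> G}"
        using elim by auto
      also have "real (card \<dots>) = (\<Sum>F\<in>?S. if F \<subseteq> G then 1 else 0)"
        using fin by (simp flip: sum.inter_filter)
      finally show ?case by (simp add: indicator_def of_bool_def)
    qed
  qed auto
  also have "\<dots> = (\<Sum>F\<in>?S. measure (graph_sample k V) {G. F \<subseteq> G})"
    by (subst Bochner_Integration.integral_sum) (auto intro!: S.integrable_bounded[where B = 1] simp: indicator_def)
  also have "\<dots> = (\<Sum>F\<in>?S. edge_kernel.hom_density unit_measure V {1..k} F)"
    using measure_graph_sample_superset[OF V] by (intro sum.cong) auto
  finally show ?thesis .
qed

section \<open>Balanced bipartite kernels\<close>

text \<open>On the unit square \<open>bipartite_graphon p\<close> is the case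
  \<open>S = {1/2..1}\<close>. A general side \<open>S\<close> is allowed because the kernel
  recovered from the moments comes with an unknown one.\<close>

definition block_kernel :: "real \<Rightarrow> 'a set \<Rightarrow> 'a \<Rightarrow> 'a \<Rightarrow> real" where
  "block_kernel p S x y = (if (x \<in> S) \<noteq> (y \<in> S) then p else 0)"

context prob_space
begin

text \<open>\<open>b\<close> stands for \<open>x \<in> S\<close> at a fixed \<open>x\<close>: the
  first form integrates over the side of \<open>x\<close>, the second over the opposite
  side.\<close>

lemma integral_half_indicator:
  assumes S: "S \<in> sets M" "prob S = 1 / 2"
  shows "(\<integral>y. (if b = (y \<in> S) then c else 0) \<partial>M) = c / (2::real)"
    and "(\<integral>y. (if b \<noteq> (y \<in> S) then c else 0) \<partial>M) = c / (2::real)"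
proof -
  have 1: "(\<integral>y. c * indicator S y \<partial>M) = c / 2"
    using S by simp
  have i: "integrable M (\<lambda>y. c * indicator S y)"
    using S(1) by (intro integrable_bounded[where B = "\<bar>c\<bar>"]) (auto simp: indicator_def)
  have 2: "(\<integral>y. c - c * indicator S y \<partial>M) = c / 2"
    using i 1 by (subst Bochner_Integration.integral_diff) (auto simp: prob_space)
  have "(\<lambda>y. if b = (y \<in> S) then c else 0) = (if b then (\<lambda>y. c * indicator S y) else (\<lambda>y. c - c * indicator S y))"
    by (auto simp: indicator_def)
  then show "(\<integral>y. (if b = (y \<in> S) then c else 0) \<partial>M) = c / (2::real)"
    using 1 2 by simp
  have "(\<lambda>y. if b \<noteq> (y \<in> S) then c else 0) = (if b then (\<lambda>y. c - c * indicator S y) else (\<lambda>y. c * indicator S y))"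
    by (auto simp: indicator_def)
  then show "(\<integral>y. (if b \<noteq> (y \<in> S) then c else 0) \<partial>M) = c / (2::real)"
    using 1 2 by simp
qed

lemma edge_kernel_block:
  assumes S: "S \<in> sets M" and p: "p \<in> {0..1}"
  shows "edge_kernel M (block_kernel p S)"
proof unfold_locales
  note [measurable] = S
  show "(\<lambda>(x, y). block_kernel p S x y) \<in> borel_measurable (M \<Otimes>\<^sub>M M)"
    unfolding block_kernel_def by measurable
qed (use p in \<open>auto simp: block_kernel_def\<close>)

text \<open>Points on the same side have the whole opposite side, of measure 1/2, as common
  neighbours; points on different sides have none. So the odd cycles have density 0, and the 4-cycle
  has \<open>(p^2 / 2)^2\<close> averaged over half of the pairs, which is
  \<open>p^4 / 8\<close>.\<close>

lemma block_kernel_densities: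
  assumes S: "S \<in> sets M" "prob S = 1 / 2" and p: "p \<in> {0..1}"
  shows "regular_kernel M (block_kernel p S) (p / 2)"
    "edge_kernel.t_C3 M (block_kernel p S) = 0"
    "edge_kernel.t_C4 M (block_kernel p S) = 2 * (p / 2) ^ 4"
    "edge_kernel.t_C5 M (block_kernel p S) = 0"
proof -
  interpret K: edge_kernel M "block_kernel p S"
    using S(1) p by (rule edge_kernel_block)
  have deg: "K.deg x = p / 2" for x
    unfolding K.deg_def block_kernel_def by (rule integral_half_indicator[OF S])
  show "regular_kernel M (block_kernel p S) (p / 2)"
    by unfold_locales (simp add: deg)
  have codeg: "K.codeg x y = (if (x \<in> S) = (y \<in> S) then p\<^sup>2 / 2 else 0)" for x y
  proof (cases "(x \<in> S) = (y \<in> S)")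
    case True
    then have "K.codeg x y = (\<integral>z. (if (x \<in> S) \<noteq> (z \<in> S) then p\<^sup>2 else 0) \<partial>M)"
      unfolding K.codeg_def block_kernel_def
      by (intro Bochner_Integration.integral_cong refl) (simp add: power2_eq_square)
    with True show ?thesis unfolding integral_half_indicator(2)[OF S] by simp
  next
    case False
    then have "K.codeg x y = (\<integral>z. 0 \<partial>M)"
      unfolding K.codeg_def block_kernel_def
      by (intro Bochner_Integration.integral_cong refl) auto
    with False show ?thesis by simp
  qed
  have 3: "block_kernel p S x y * K.codeg x y = 0" for x y
    by (simp add: codeg block_kernel_def)
  show "K.t_C3 = 0" by (simp add: K.t_C3_def 3)
  have 4: "(\<integral>y. (K.codeg x y)\<^sup>2 \<partial>M) = p ^ 4 / 8" for x
  proof -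
    have "(\<integral>y. (K.codeg x y)\<^sup>2 \<partial>M) = (\<integral>y. (if (x \<in> S) = (y \<in> S) then p ^ 4 / 4 else 0) \<partial>M)"
      by (intro Bochner_Integration.integral_cong refl) (simp add: codeg power2_eq_square power4_eq_xxxx)
    then show ?thesis unfolding integral_half_indicator(1)[OF S] by simp
  qed
  show "K.t_C4 = 2 * (p / 2) ^ 4"
    unfolding K.t_C4_def 4 by (simp add: prob_space power_divide)
  have 5: "block_kernel p S x y * (\<integral>z. K.codeg x z * K.codeg y z \<partial>M) = 0" for x y
  proof (cases "(x \<in> S) = (y \<in> S)")
    case False
    then have "(\<integral>z. K.codeg x z * K.codeg y z \<partial>M) = (\<integral>z. 0 \<partial>M)"
      by (intro Bochner_Integration.integral_cong refl) (auto simp: codeg)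
    then show ?thesis by simp
  qed (simp add: block_kernel_def)
  show "K.t_C5 = 0" by (simp add: K.t_C5_def 5)
qed

section \<open>Samples of block kernels depend only on the measure of the side\<close>

lemma distr_PiM_componentwise:
  assumes I: "finite I" and f: "f \<in> M \<rightarrow>\<^sub>M N"
  shows "distr (\<Pi>\<^sub>M i\<in>I. M) (\<Pi>\<^sub>M i\<in>I. N) (\<lambda>x. \<lambda>i\<in>I. f (x i)) = (\<Pi>\<^sub>M i\<in>I. distr M N f)"
proof -
  interpret product_sigma_finite "\<lambda>_. M" ..
  interpret D: prob_space "distr M N f" by (rule prob_space_distr) fact
  interpret D: product_sigma_finite "\<lambda>_. distr M N f" ..
  note [measurable] = f
  have m: "(\<lambda>x. \<lambda>i\<in>I. f (x i)) \<in> (\<Pi>\<^sub>M i\<in>I. M) \<rightarrow>\<^sub>M (\<Pi>\<^sub>M i\<in>I. N)"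
    by measurable
  show ?thesis
  proof (rule D.PiM_eqI[OF I])
    show "sets (distr (\<Pi>\<^sub>M i\<in>I. M) (\<Pi>\<^sub>M i\<in>I. N) (\<lambda>x. \<lambda>i\<in>I. f (x i))) = sets (\<Pi>\<^sub>M i\<in>I. distr M N f)"
      unfolding sets_distr by (intro sets_PiM_cong) auto
    fix A assume A: "\<And>i. i \<in> I \<Longrightarrow> A i \<in> sets (distr M N f)"
    have "emeasure (distr (\<Pi>\<^sub>M i\<in>I. M) (\<Pi>\<^sub>M i\<in>I. N) (\<lambda>x. \<lambda>i\<in>I. f (x i))) (Pi\<^sub>E I A)
      = emeasure (\<Pi>\<^sub>M i\<in>I. M) ((\<lambda>x. \<lambda>i\<in>I. f (x i)) -` Pi\<^sub>E I A \<inter> space (\<Pi>\<^sub>M i\<in>I. M))"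
      using A I by (intro emeasure_distr m sets_PiM_I_finite) auto
    also have "(\<lambda>x. \<lambda>i\<in>I. f (x i)) -` Pi\<^sub>E I A \<inter> space (\<Pi>\<^sub>M i\<in>I. M) = Pi\<^sub>E I (\<lambda>i. f -` A i \<inter> space M)"
      by (auto simp: space_PiM PiE_iff extensional_def)
    also have "emeasure (\<Pi>\<^sub>M i\<in>I. M) \<dots> = (\<Prod>i\<in>I. emeasure M (f -` A i \<inter> space M))"
      using A I by (intro emeasure_PiM) (auto intro: measurable_sets[OF f])
    also have "\<dots> = (\<Prod>i\<in>I. emeasure (distr M N f) (A i))"
      using A by (intro prod.cong refl) (simp add: emeasure_distr[OF f])
    finally show "emeasure (distr (\<Pi>\<^sub>M i\<in>I. M) (\<Pi>\<^sub>M i\<in>I. N) (\<lambda>x. \<lambda>i\<in>I. f (x i))) (Pi\<^sub>E I A)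
      = (\<Prod>i\<in>I. emeasure (distr M N f) (A i))" .
  qed
qed

lemma distr_indicator_cong:
  assumes "S \<in> sets M" "T \<in> sets M" "prob S = prob T"
  shows "distr M (count_space UNIV) (\<lambda>x. x \<in> S) = distr M (count_space UNIV) (\<lambda>x. x \<in> T)"
proof (rule measure_eqI)
  note [measurable] = assms(1,2)
  have *: "emeasure (distr M (count_space UNIV) (\<lambda>x. x \<in> R)) A =
      ennreal (of_bool (True \<in> A) * prob R + of_bool (False \<in> A) * (1 - prob R))"
    if [measurable]: "R \<in> sets M" for R A
  proof -
    have "emeasure (distr M (count_space UNIV) (\<lambda>x. x \<in> R)) A = emeasure M ((\<lambda>x. x \<in> R) -` A \<inter> space M)"
      by (rule emeasure_distr) auto
    also have "(\<lambda>x. x \<in> R) -` A \<inter> space M =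
      (if True \<in> A then if False \<in> A then space M else R else if False \<in> A then space M - R else {})"
    proof (rule set_eqI)
      show "x \<in> (\<lambda>x. x \<in> R) -` A \<inter> space M \<longleftrightarrow>
        x \<in> (if True \<in> A then if False \<in> A then space M else R else if False \<in> A then space M - R else {})" for x
        using sets.sets_into_space[OF that] by (cases "x \<in> R") auto
    qed
    also have "emeasure M \<dots> = ennreal (of_bool (True \<in> A) * prob R + of_bool (False \<in> A) * (1 - prob R))"
      using that by (auto simp: emeasure_eq_measure prob_space prob_compl simp del: ennreal_plus)
    finally show ?thesis .
  qed
  show "emeasure (distr M (count_space UNIV) (\<lambda>x. x \<in> S)) A = emeasure (distr M (count_space UNIV) (\<lambda>x. x \<in> T)) A" for A
    by (simp only: * assms)
qed simp

end

text \<open>The types enter only through the bits \<open>x i \<in> R\<close>. These are independent,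
  and their law is determined by the measure of \<open>R\<close>, so \<open>S\<close> and
  \<open>T\<close> yield the same joint law.\<close>

lemma graph_sample_block_cong:
  assumes S: "S \<in> sets unit_measure" "T \<in> sets unit_measure" "measure unit_measure S = measure unit_measure T"
    and p: "p \<in> {0..1}"
  shows "graph_sample k (block_kernel p S) = graph_sample k (block_kernel p T)"
proof (rule measure_eqI)
  interpret M: prob_space unit_measure by (rule prob_space_unit_interval)
  let ?I = "{1..k}"
  let ?B = "\<Pi>\<^sub>M i\<in>?I. count_space (UNIV :: bool set)"
  show "sets (graph_sample k (block_kernel p S)) = sets (graph_sample k (block_kernel p T))"
    by (simp add: sets_graph_sample)
  fix A
  \<comment> \<open>The conditional probability of \<open>A\<close> given the sides \<open>s\<close>
    of the vertices.\<close>
  define \<Phi> where "\<Phi> s = emeasure (measure_pmf (map_pmf (\<lambda>b. {e \<in> vertex_pairs k. b e})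
      (Pi_pmf (vertex_pairs k) False (\<lambda>e. bernoulli_pmf (if s (Min e) \<noteq> s (Max e) then p else 0))))) A"
    for s :: "nat \<Rightarrow> bool"
  \<comment> \<open>Finitely many bits form a discrete space, on which \<Phi> is trivially
    measurable.\<close>
  have B: "?B = count_space (PiE ?I (\<lambda>_. UNIV))"
    by (rule count_space_PiM_finite) auto
  have \<Phi>: "emeasure (graph_sample k (block_kernel p R)) A =
      (\<integral>\<^sup>+s. \<Phi> s \<partial>(\<Pi>\<^sub>M i\<in>?I. distr unit_measure (count_space UNIV) (\<lambda>x. x \<in> R)))"
    if R: "R \<in> sets unit_measure" for R
  proof -
    let ?f = "\<lambda>x. \<lambda>i\<in>?I. x i \<in> R"
    have m: "(\<lambda>x. x \<in> R) \<in> unit_measure \<rightarrow>\<^sub>M count_space UNIV"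
      using R by measurable
    have m': "?f \<in> (\<Pi>\<^sub>M i\<in>?I. unit_measure) \<rightarrow>\<^sub>M ?B"
      using R by measurable
    have g: "graphon (block_kernel p R)"
      using M.edge_kernel_block[OF R p] by (rule edge_kernel_imp_graphon)
    have e: "edges_given_types k (block_kernel p R) x = map_pmf (\<lambda>b. {e \<in> vertex_pairs k. b e})
      (Pi_pmf (vertex_pairs k) False (\<lambda>e. bernoulli_pmf (if ?f x (Min e) \<noteq> ?f x (Max e) then p else 0)))" for x
      unfolding edges_given_types_def block_kernel_def
      by (intro arg_cong[where f = "map_pmf _"] Pi_pmf_cong refl) (use vertex_pairs_MinMax in auto)
    have "emeasure (graph_sample k (block_kernel p R)) A = (\<integral>\<^sup>+x. \<Phi> (?f x) \<partial>(\<Pi>\<^sub>M i\<in>?I. unit_measure))"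
      unfolding emeasure_graph_sample[OF g] vertex_types_def nn_integral_completion e \<Phi>_def ..
    also have "\<dots> = (\<integral>\<^sup>+s. \<Phi> s \<partial>distr (\<Pi>\<^sub>M i\<in>?I. unit_measure) ?B ?f)"
      by (rule nn_integral_distr[OF m', symmetric]) (unfold B, simp)
    also have "distr (\<Pi>\<^sub>M i\<in>?I. unit_measure) ?B ?f = (\<Pi>\<^sub>M i\<in>?I. distr unit_measure (count_space UNIV) (\<lambda>x. x \<in> R))"
      by (rule M.distr_PiM_componentwise[OF _ m]) simp
    finally show ?thesis .
  qed
  show "emeasure (graph_sample k (block_kernel p S)) A = emeasure (graph_sample k (block_kernel p T)) A"
    unfolding \<Phi>[OF S(1)] \<Phi>[OF S(2)] M.distr_indicator_cong[OF S] ..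
qed

section \<open>Forcing by the edge count of the 5-sample\<close>

theorem theorem4:
  fixes p :: real
  assumes "p \<in> {0..1}"
  shows "\<forall>U. graphon U \<longrightarrow>
           edge_count_distr 5 U = edge_count_distr 5 (bipartite_graphon p) \<longrightarrow>
           weakly_isomorphic U (bipartite_graphon p)"
proof (intro allI impI)
  fix U assume U: "graphon U" and eq: "edge_count_distr 5 U = edge_count_distr 5 (bipartite_graphon p)"
  interpret M: prob_space unit_measure by (rule prob_space_unit_interval)
  \<comment> \<open>The point 1/2 belongs to the upper side, as in \<open>bipartite_graphon\<close>,
    so the two kernels agree at every point of the unit square.\<close>
  define T where "T = {1/2..1::real}"
  have T: "T \<in> sets unit_measure" "measure unit_measure T = 1 / 2"
    by (auto simp: T_def sets_restrict_space_iff measure_restrict_space)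
  let ?K = "block_kernel p T"
  have K: "edge_kernel unit_measure ?K" by (rule M.edge_kernel_block[OF T(1) assms])
  note gK = edge_kernel_imp_graphon[OF K]
  have W: "graph_sample k (bipartite_graphon p) = graph_sample k ?K" for k
  proof (rule graph_sample_cong[OF graphon_bipartite_graphon[OF assms] gK AE_I2])
    fix z assume "z \<in> space (unit_measure \<Otimes>\<^sub>M unit_measure)"
    then show "bipartite_graphon p (fst z) (snd z) = ?K (fst z) (snd z)"
      unfolding space_unit_square by (auto simp: bipartite_graphon_def block_kernel_def T_def)
  qed
  obtain V where V: "edge_kernel unit_measure V"
    and UV: "AE z in unit_measure \<Otimes>\<^sub>M unit_measure. U (fst z) (snd z) = V (fst z) (snd z)"
    using graphon_ex_edge_kernel[OF U] .
  note gV = edge_kernel_imp_graphon[OF V]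
  have UV': "graph_sample k U = graph_sample k V" for k
    by (rule graph_sample_cong[OF U gV UV])
  have "edge_count_distr 5 V = edge_count_distr 5 ?K"
    using eq by (simp add: edge_count_distr_def UV' W)
  then have moments: "(\<Sum>F | F \<subseteq> vertex_pairs 5 \<and> card F = m. edge_kernel.hom_density unit_measure V {1..5} F)
      = (\<Sum>F | F \<subseteq> vertex_pairs 5 \<and> card F = m. edge_kernel.hom_density unit_measure ?K {1..5} F)" for m
    using edge_count_factorial_moment[OF V gV, of 5 m] edge_count_factorial_moment[OF K gK, of 5 m] by simp
  note dens = M.block_kernel_densities[OF T assms]
  note det = hom_moments_determine[OF V dens(1) moments dens(2)]
  interpret V: regular_kernel unit_measure V "p / 2" by (rule det(1))
  have "\<exists>S\<in>sets unit_measure. measure unit_measure S = 1 / 2 \<and>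
    (AE x in unit_measure. AE y in unit_measure. V x y = block_kernel p S x y)"
  proof (cases "p = 0")
    \<comment> \<open>The block structure was derived for positive degree only. For
      \<open>p = 0\<close> all degrees vanish, hence so does \<open>V\<close> almost everywhere, and
      any set of measure 1/2 serves as the side.\<close>
    case True
    have "AE x in unit_measure. AE y in unit_measure. V x y = 0"
      using V.deg_eq AE_space
    proof eventually_elim
      case (elim x)
      then show ?case
        using integral_nonneg_eq_0_iff_AE[OF V.integrable_kernel[OF elim(2)]] True
        by (simp add: V.deg_def V.kernel_nonneg)
    qed
    with True T show ?thesis by (intro bexI[of _ T]) (auto simp: block_kernel_def)
  next
    case False
    then have "0 < p / 2" using assms by simp
    have C4: "V.t_C4 = 2 * (p / 2) ^ 4" and C5: "V.t_C5 = 0"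
      using det(3,4) dens(3,4) by simp_all
    have two: "2 * (p / 2) = p" by simp
    show ?thesis
      using V.AE_two_block[OF \<open>0 < p / 2\<close> det(2) C4 C5] unfolding block_kernel_def two .
  qed
  then obtain S where S: "S \<in> sets unit_measure" "measure unit_measure S = 1 / 2"
    and VS: "AE x in unit_measure. AE y in unit_measure. V x y = block_kernel p S x y"
    by blast
  have KS: "edge_kernel unit_measure (block_kernel p S)" by (rule M.edge_kernel_block[OF S(1) assms])
  interpret KS: edge_kernel unit_measure "block_kernel p S" by (rule KS)
  have "AE z in unit_measure \<Otimes>\<^sub>M unit_measure. V (fst z) (snd z) = block_kernel p S (fst z) (snd z)"
    using VS by (subst V.P.AE_pair_iff[symmetric]) auto
  then have "graph_sample k V = graph_sample k (block_kernel p S)" for k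
    by (rule graph_sample_cong[OF gV edge_kernel_imp_graphon[OF KS]])
  \<comment> \<open>The unknown side \<open>S\<close> is exchanged for \<open>T\<close>, which has
    the same measure 1/2.\<close>
  also have "graph_sample k (block_kernel p S) = graph_sample k ?K" for k
    using S T by (intro graph_sample_block_cong assms) auto
  finally show "weakly_isomorphic U (bipartite_graphon p)"
    by (simp add: weakly_isomorphic_def UV' W)
qed

end
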